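(* Let $u_0,f,g\in L^2(D)$ and let $R\in L^\infty([0,T])$ satisfy $0<C_R\le R(t)$ for almost every $t\in[0,T]$, where $C_R$ is a positive constant. Let $f^0$ be a (deterministic) prior function with $f-f^0\in H^2(D)$, and assume $h,h^{\delta,N}\in L^2(D)$, where $h$ is the noise-free data and $h^{\delta,N}$ is the random data obtained from $N^2$ independent observations. Define $$\delta=\frac{\sqrt{C_\lambda}}{N}\|g\|_{L^2(D)},\qquad C_\lambda=\frac{1}{2\lambda_1}.$$ Then there exist constants $C,C_1>0$ such that if $\gamma=C_1\delta^{2/3}$, the exact source term $f$ and the minimizer $f_\gamma^\delta$ over $v\in L^2(D)$ of $$J_\gamma[v]=\frac12\left\|F(v)-h^{\delta,N}\right\|_{L^2(D)}^2+\frac{\gamma}{2}\left\|v-f^0\right\|_{L^2(D)}^2$$ satisfy $$\mathbb{E}\left[\left\|f-f_\gamma^\delta\right\|_{L^2(D)}^2\right]\le C\,\delta^{4/3},$$ where $$C=\frac{2K^2C_1^2}{(C_RC_0)^4}+\frac{1}{2C_1},\qquad K=\|f-f^0\|_{H^2(D)},\qquad C_0=1-e^{-\lambda_1T}.$$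
   Context: Let $T>0$, let $N\ge1$ be an integer, and let $D\subset\mathbb{R}^d$ ($d=1,2,3$) be a bounded domain with Lipschitz boundary. The operator $A$ is the symmetric uniformly elliptic operator with homogeneous Dirichlet boundary condition $Au(x)=\sum_{i,j=1}^d(a_{ij}(x)u_{x_i}(x))_{x_j}-c(x)u(x)$ for $u\in H^2(D)\cap H^1_0(D)$, where $c,a_{ij}\in C^1(\bar D)$, $c\ge 0$, $a_{ij}=a_{ji}$, and there is a constant $a_0>0$ with $a_0\sum_{i}\xi_i^2\le\sum_{i,j}a_{ij}(x)\xi_i\xi_j$ for all $x\in\bar D$, $\xi\in\mathbb{R}^d$. The eigensystem of $-A$ (with Dirichlet boundary conditions) is $\{\lambda_n,\varphi_n\}_{n\ge1}$, with $0<\lambda_1\le\lambda_2\le\cdots$, $\lambda_n\to\infty$, and $\{\varphi_n\}$ a complete orthonormal basis of $L^2(D)$, $A\varphi_n=-\lambda_n\varphi_n$. The process $w=\{w(t)\}_{t\ge0}$ is a standard real-valued Brownian motion on a complete filtered probability space $(\Omega,\mathcal{F},\{\mathcal{F}_t\}_{t\ge0},\mathbb{P})$. The functions $u_0,f,g$ depend only on $x$ and are deterministic; $R$ depends only on $t$ and is deterministic. For $v\in L^2(D)$ write $v_n=(v,\varphi_n)_{L^2(D)}$, and $u_{0,n}=(u_0,\varphi_n)_{L^2(D)}$. The mild solution of $du=Au\,dt+Rf\,dt+g\,dw$, $u(0)=u_0$, is $$u(x,t)=\sum_{n=1}^\infty\left(e^{-\lambda_nt}u_{0,n}+\int_0^te^{-\lambda_n(t-s)}R(s)f_n\,ds+\int_0^te^{-\lambda_n(t-s)}g_n\,dw(s)\right)\varphi_n(x),\quad\mathbb{P}\text{-a.s.}$$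 The forward operator $F:L^2(D)\to L^2(D)$ is $$F(v)=\sum_{n=1}^\infty\left(\int_0^Te^{-\lambda_n(T-s)}R(s)\,ds\right)v_n\,\varphi_n .$$ The noise-free data is $h=F(f)=\mathbb{E}[u(\cdot,T)]-\sum_{n}e^{-\lambda_nT}u_{0,n}\varphi_n$. The observed data are $N^2$ independent observations $h^{(1)},\dots,h^{(N^2)}$ of $u(\cdot,T)$ (independent copies of the terminal value of the mild solution), $h^N=\frac1{N^2}\sum_{i=1}^{N^2}h^{(i)}$ is their sample mean, and $h^{\delta,N}=h^N-\sum_ne^{-\lambda_nT}u_{0,n}\varphi_n$. The regularization parameter $\gamma$ in $J_\gamma$ is positive; for each realization of $h^{\delta,N}$, $f_\gamma^\delta$ denotes the corresponding minimizer of $J_\gamma$, so $f_\gamma^\delta$ is random, and the expectation is over the observations. Convention: $v\in H^2(D)$ means $\sum_{n=1}^\infty\lambda_n^4v_n^2<\infty$, with $\|v\|_{H^2(D)}^2=\sum_{n=1}^\infty\lambda_n^4v_n^2$. *)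

theory Defs
  imports "HOL-Analysis.Analysis" "HOL-Probability.Probability"
begin

section \<open>Square-integrable functions\<close>

text \<open>Elements of \<open>L\<^sup>2\<close> are represented by functions; equality of classes is equality almost
  everywhere. For \<open>M = lebesgue_on D\<close> the values outside \<open>D\<close> are irrelevant.\<close>

definition L2 :: "'a measure \<Rightarrow> ('a \<Rightarrow> real) set" where
  "L2 M = {v. v \<in> borel_measurable M \<and> integrable M (\<lambda>x. (v x)\<^sup>2)}"

definition l2_inner :: "'a measure \<Rightarrow> ('a \<Rightarrow> real) \<Rightarrow> ('a \<Rightarrow> real) \<Rightarrow> real" where
  "l2_inner M u v = (LINT x|M. u x * v x)"

definition l2_norm :: "'a measure \<Rightarrow> ('a \<Rightarrow> real) \<Rightarrow> real" where
  "l2_norm M v = sqrt (l2_inner M v v)"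

definition l2_sums ::
  "'a measure \<Rightarrow> (nat \<Rightarrow> 'a \<Rightarrow> real) \<Rightarrow> (nat \<Rightarrow> real) \<Rightarrow> ('a \<Rightarrow> real) \<Rightarrow> bool" where
  "l2_sums M phi b v \<longleftrightarrow>
     v \<in> L2 M \<and> (\<lambda>n. l2_norm M (\<lambda>x. v x - (\<Sum>k<n. b k * phi k x))) \<longlonglongrightarrow> 0"

text \<open>The sum of the series, unique up to equality almost everywhere.\<close>

definition l2_series ::
  "'a measure \<Rightarrow> (nat \<Rightarrow> 'a \<Rightarrow> real) \<Rightarrow> (nat \<Rightarrow> real) \<Rightarrow> 'a \<Rightarrow> real" where
  "l2_series M phi b = (SOME v. l2_sums M phi b v)"

definition orthonormal_basis :: "'a measure \<Rightarrow> (nat \<Rightarrow> 'a \<Rightarrow> real) \<Rightarrow> bool" where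
  "orthonormal_basis M phi \<longleftrightarrow>
     (\<forall>n. phi n \<in> L2 M) \<and>
     (\<forall>m n. l2_inner M (phi m) (phi n) = (if m = n then 1 else 0)) \<and>
     (\<forall>v\<in>L2 M. l2_sums M phi (\<lambda>n. l2_inner M v (phi n)) v)"

definition l2_open :: "'a measure \<Rightarrow> ('a \<Rightarrow> real) set \<Rightarrow> bool" where
  "l2_open M U \<longleftrightarrow>
     U \<subseteq> L2 M \<and>
     (\<forall>u\<in>U. \<exists>e>0. \<forall>v\<in>L2 M. l2_norm M (\<lambda>x. v x - u x) < e \<longrightarrow> v \<in> U)"

text \<open>The Borel \<open>\<sigma>\<close>-algebra of the \<open>L\<^sup>2\<close> seminorm topology.\<close>

definition L2_borel :: "'a measure \<Rightarrow> ('a \<Rightarrow> real) measure" where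
  "L2_borel M = sigma (L2 M) {U. l2_open M U}"

definition Linfty :: "'a measure \<Rightarrow> ('a \<Rightarrow> real) set" where
  "Linfty M = {v. v \<in> borel_measurable M \<and> (\<exists>B. AE x in M. \<bar>v x\<bar> \<le> B)}"


section \<open>The domain and Sobolev spaces\<close>

text \<open>Near each boundary point the domain is the part of a ball lying above the graph of a Lipschitz
  function over the hyperplane orthogonal to a unit vector \<open>e\<close>.\<close>

definition lipschitz_boundary :: "(real ^ 'd) set \<Rightarrow> bool" where
  "lipschitz_boundary D \<longleftrightarrow>
     (\<forall>p\<in>frontier D. \<exists>r>0. \<exists>e. norm e = 1 \<and>
        (\<exists>(\<psi>::real ^ 'd \<Rightarrow> real) L. L-lipschitz_on {y. y \<bullet> e = 0} \<psi> \<and>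
           D \<inter> ball p r = {x \<in> ball p r. \<psi> (x - (x \<bullet> e) *\<^sub>R e) < x \<bullet> e}))"

definition bounded_lipschitz_domain :: "(real ^ 'd) set \<Rightarrow> bool" where
  "bounded_lipschitz_domain D \<longleftrightarrow>
     open D \<and> connected D \<and> D \<noteq> {} \<and> bounded D \<and> lipschitz_boundary D"

definition partial_deriv :: "'d \<Rightarrow> (real ^ 'd \<Rightarrow> real) \<Rightarrow> real ^ 'd \<Rightarrow> real" where
  "partial_deriv i f x = frechet_derivative f (at x) (axis i 1)"

primrec Ck :: "nat \<Rightarrow> (real ^ 'd \<Rightarrow> real) \<Rightarrow> bool" where
  "Ck 0 f \<longleftrightarrow> continuous_on UNIV f"
| "Ck (Suc k) f \<longleftrightarrow> (\<forall>x. f differentiable (at x)) \<and> (\<forall>i. Ck k (partial_deriv i f))"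

definition test_functions :: "(real ^ 'd) set \<Rightarrow> (real ^ 'd \<Rightarrow> real) set" where
  "test_functions D =
     {\<psi>. (\<forall>k. Ck k \<psi>) \<and> compact (closure {x. \<psi> x \<noteq> 0}) \<and> closure {x. \<psi> x \<noteq> 0} \<subseteq> D}"

text \<open>\<open>C\<^sup>1\<close> up to the boundary: \<open>u\<close> and its classical derivative in \<open>D\<close> extend continuously to
  the closure.\<close>

definition C1_closure :: "(real ^ 'd) set \<Rightarrow> (real ^ 'd \<Rightarrow> real) \<Rightarrow> bool" where
  "C1_closure D u \<longleftrightarrow>
     continuous_on (closure D) u \<and>
     (\<exists>u'. continuous_on (closure D) u' \<and>
           (\<forall>x\<in>D. (u has_derivative (\<lambda>h. u' x \<bullet> h)) (at x)))"

definition has_weak_partial ::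
  "(real ^ 'd) set \<Rightarrow> 'd \<Rightarrow> (real ^ 'd \<Rightarrow> real) \<Rightarrow> (real ^ 'd \<Rightarrow> real) \<Rightarrow> bool" where
  "has_weak_partial D i u v \<longleftrightarrow>
     u \<in> L2 (lebesgue_on D) \<and> v \<in> L2 (lebesgue_on D) \<and>
     (\<forall>\<psi>\<in>test_functions D.
        (LINT x|lebesgue_on D. u x * partial_deriv i \<psi> x) = - (LINT x|lebesgue_on D. v x * \<psi> x))"

definition weak_partial ::
  "(real ^ 'd) set \<Rightarrow> 'd \<Rightarrow> (real ^ 'd \<Rightarrow> real) \<Rightarrow> real ^ 'd \<Rightarrow> real" where
  "weak_partial D i u = (SOME v. has_weak_partial D i u v)"

definition sobolev_H1 :: "(real ^ 'd) set \<Rightarrow> (real ^ 'd \<Rightarrow> real) set" where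
  "sobolev_H1 D = {u \<in> L2 (lebesgue_on D). \<forall>i. \<exists>v. has_weak_partial D i u v}"

definition sobolev_H2 :: "(real ^ 'd) set \<Rightarrow> (real ^ 'd \<Rightarrow> real) set" where
  "sobolev_H2 D = {u \<in> sobolev_H1 D. \<forall>i. weak_partial D i u \<in> sobolev_H1 D}"

text \<open>The closure of the test functions in the \<open>H\<^sup>1\<close> norm.\<close>

definition sobolev_H10 :: "(real ^ 'd) set \<Rightarrow> (real ^ 'd \<Rightarrow> real) set" where
  "sobolev_H10 D = {u \<in> sobolev_H1 D. \<exists>\<psi>.
     (\<forall>k. \<psi> k \<in> test_functions D) \<and>
     (\<lambda>k::nat. l2_norm (lebesgue_on D) (\<lambda>x. u x - \<psi> k x)) \<longlonglongrightarrow> 0 \<and>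
     (\<forall>i. (\<lambda>k. l2_norm (lebesgue_on D)
                (\<lambda>x. weak_partial D i u x - partial_deriv i (\<psi> k) x)) \<longlonglongrightarrow> 0)}"


section \<open>The elliptic operator and its eigensystem\<close>

definition elliptic_coefficients ::
  "(real ^ 'd) set \<Rightarrow> ('d \<Rightarrow> 'd \<Rightarrow> real ^ 'd \<Rightarrow> real) \<Rightarrow> (real ^ 'd \<Rightarrow> real) \<Rightarrow> bool" where
  "elliptic_coefficients D a c \<longleftrightarrow>
     (\<forall>i j. C1_closure D (a i j)) \<and> C1_closure D c \<and>
     (\<forall>x\<in>closure D. 0 \<le> c x) \<and>
     (\<forall>i j. \<forall>x\<in>closure D. a i j x = a j i x) \<and>
     (\<exists>a0>0. \<forall>x\<in>closure D. \<forall>\<xi>::real ^ 'd.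
        a0 * (\<Sum>i\<in>UNIV. (\<xi> $ i)\<^sup>2) \<le> (\<Sum>i\<in>UNIV. \<Sum>j\<in>UNIV. a i j x * \<xi> $ i * \<xi> $ j))"

definition elliptic_op ::
  "(real ^ 'd) set \<Rightarrow> ('d \<Rightarrow> 'd \<Rightarrow> real ^ 'd \<Rightarrow> real) \<Rightarrow> (real ^ 'd \<Rightarrow> real) \<Rightarrow>
   (real ^ 'd \<Rightarrow> real) \<Rightarrow> real ^ 'd \<Rightarrow> real" where
  "elliptic_op D a c u x =
     (\<Sum>i\<in>UNIV. \<Sum>j\<in>UNIV. weak_partial D j (\<lambda>y. a i j y * weak_partial D i u y) x) - c x * u x"

text \<open>Eigenvalues and eigenfunctions are numbered from \<open>0\<close>, so \<open>lam 0\<close> is the smallest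
  eigenvalue, usually written \<open>\<lambda>\<^sub>1\<close>.\<close>

definition dirichlet_eigensystem ::
  "(real ^ 'd) set \<Rightarrow> ('d \<Rightarrow> 'd \<Rightarrow> real ^ 'd \<Rightarrow> real) \<Rightarrow> (real ^ 'd \<Rightarrow> real) \<Rightarrow>
   (nat \<Rightarrow> real) \<Rightarrow> (nat \<Rightarrow> real ^ 'd \<Rightarrow> real) \<Rightarrow> bool" where
  "dirichlet_eigensystem D a c lam phi \<longleftrightarrow>
     0 < lam 0 \<and> incseq lam \<and> filterlim lam at_top sequentially \<and>
     orthonormal_basis (lebesgue_on D) phi \<and>
     (\<forall>n. phi n \<in> sobolev_H2 D \<inter> sobolev_H10 D \<and>
          (AE x in lebesgue_on D. elliptic_op D a c (phi n) x = - lam n * phi n x))"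

abbreviation coef ::
  "(real ^ 'd) set \<Rightarrow> (nat \<Rightarrow> real ^ 'd \<Rightarrow> real) \<Rightarrow> (real ^ 'd \<Rightarrow> real) \<Rightarrow> nat \<Rightarrow> real" where
  "coef D phi v n \<equiv> l2_inner (lebesgue_on D) v (phi n)"

text \<open>The regularity class of the source condition is spectral, with weight \<open>\<lambda>\<^sub>n\<^sup>4\<close>;
  it is distinct from \<^const>\<open>sobolev_H2\<close>.\<close>

definition spectral_H2 ::
  "(real ^ 'd) set \<Rightarrow> (nat \<Rightarrow> real) \<Rightarrow> (nat \<Rightarrow> real ^ 'd \<Rightarrow> real) \<Rightarrow> (real ^ 'd \<Rightarrow> real) set" where
  "spectral_H2 D lam phi =
     {v \<in> L2 (lebesgue_on D). summable (\<lambda>n. lam n ^ 4 * (coef D phi v n)\<^sup>2)}"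

definition spectral_H2_norm ::
  "(real ^ 'd) set \<Rightarrow> (nat \<Rightarrow> real) \<Rightarrow> (nat \<Rightarrow> real ^ 'd \<Rightarrow> real) \<Rightarrow> (real ^ 'd \<Rightarrow> real) \<Rightarrow> real" where
  "spectral_H2_norm D lam phi v = sqrt (\<Sum>n. lam n ^ 4 * (coef D phi v n)\<^sup>2)"


section \<open>Brownian motion and the Wiener integral\<close>

definition complete_filtered_prob_space :: "'w measure \<Rightarrow> (real \<Rightarrow> 'w measure) \<Rightarrow> bool" where
  "complete_filtered_prob_space M F \<longleftrightarrow>
     prob_space M \<and> complete_measure M \<and>
     (\<forall>t\<ge>0. subalgebra M (F t)) \<and>
     (\<forall>s t. 0 \<le> s \<and> s \<le> t \<longrightarrow> sets (F s) \<subseteq> sets (F t)) \<and>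
     null_sets M \<subseteq> sets (F 0)"

definition brownian_motion ::
  "'w measure \<Rightarrow> (real \<Rightarrow> 'w measure) \<Rightarrow> (real \<Rightarrow> 'w \<Rightarrow> real) \<Rightarrow> bool" where
  "brownian_motion M F w \<longleftrightarrow>
     (\<forall>t\<ge>0. w t \<in> borel_measurable (F t)) \<and>
     (AE \<omega> in M. w 0 \<omega> = 0) \<and>
     (AE \<omega> in M. continuous_on {0..} (\<lambda>t. w t \<omega>)) \<and>
     (\<forall>s t. 0 \<le> s \<and> s < t \<longrightarrow>
        prob_space.indep_set M (sets (F s))
          {(\<lambda>\<omega>. w t \<omega> - w s \<omega>) -` B \<inter> space M | B. B \<in> sets borel} \<and>
        distributed M lborel (\<lambda>\<omega>. w t \<omega> - w s \<omega>) (normal_density 0 (sqrt (t - s))))"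

definition step_fun :: "nat \<Rightarrow> (nat \<Rightarrow> real) \<Rightarrow> (nat \<Rightarrow> real) \<Rightarrow> real \<Rightarrow> real" where
  "step_fun m s b r = (\<Sum>k<m. b k * indicator {s k<..s (Suc k)} r)"

definition step_integral ::
  "(real \<Rightarrow> 'w \<Rightarrow> real) \<Rightarrow> nat \<Rightarrow> (nat \<Rightarrow> real) \<Rightarrow> (nat \<Rightarrow> real) \<Rightarrow> 'w \<Rightarrow> real" where
  "step_integral w m s b \<omega> = (\<Sum>k<m. b k * (w (s (Suc k)) \<omega> - w (s k) \<omega>))"

text \<open>\<open>I\<close> is (a version of) the stochastic integral over \<open>[0,t]\<close> of the deterministic square-integrable
  integrand \<open>\<eta>\<close>: the mean-square limit of the integrals of step functions converging to
  \<open>\<eta>\<close> in \<open>L\<^sup>2(0,t)\<close>. By the Ito isometry it does not depend on the approximating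
  sequence.\<close>

definition has_wiener_integral ::
  "'w measure \<Rightarrow> (real \<Rightarrow> 'w \<Rightarrow> real) \<Rightarrow> real \<Rightarrow> (real \<Rightarrow> real) \<Rightarrow> ('w \<Rightarrow> real) \<Rightarrow> bool" where
  "has_wiener_integral M w t \<eta> I \<longleftrightarrow>
     \<eta> \<in> L2 (lebesgue_on {0..t}) \<and> I \<in> L2 M \<and>
     (\<exists>(m :: nat \<Rightarrow> nat) s b.
        (\<forall>n. (\<forall>k\<le>m n. s n k \<in> {0..t}) \<and> (\<forall>k<m n. s n k \<le> s n (Suc k))) \<and>
        (\<lambda>n. l2_norm (lebesgue_on {0..t}) (\<lambda>r. step_fun (m n) (s n) (b n) r - \<eta> r)) \<longlonglongrightarrow> 0 \<and>
        (\<lambda>n. l2_norm M (\<lambda>\<omega>. step_integral w (m n) (s n) (b n) \<omega> - I \<omega>)) \<longlonglongrightarrow> 0)"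


section \<open>Mild solution, forward operator, data and Tikhonov functional\<close>

definition mild_solution ::
  "'w measure \<Rightarrow> (real \<Rightarrow> 'w \<Rightarrow> real) \<Rightarrow> (real ^ 'd) set \<Rightarrow> (nat \<Rightarrow> real) \<Rightarrow>
   (nat \<Rightarrow> real ^ 'd \<Rightarrow> real) \<Rightarrow> real \<Rightarrow> (real \<Rightarrow> real) \<Rightarrow> (real ^ 'd \<Rightarrow> real) \<Rightarrow>
   (real ^ 'd \<Rightarrow> real) \<Rightarrow> (real ^ 'd \<Rightarrow> real) \<Rightarrow> (real \<Rightarrow> 'w \<Rightarrow> real ^ 'd \<Rightarrow> real) \<Rightarrow> bool" where
  "mild_solution M w D lam phi T R u0 f g u \<longleftrightarrow>
     (\<forall>t\<in>{0..T}. u t \<in> measurable M (L2_borel (lebesgue_on D)) \<and>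
        (\<exists>W. (\<forall>n. has_wiener_integral M w t
                    (\<lambda>s. exp (- lam n * (t - s)) * coef D phi g n) (W n)) \<and>
             (AE \<omega> in M. l2_sums (lebesgue_on D) phi
                (\<lambda>n. exp (- lam n * t) * coef D phi u0 n
                     + (LINT s|lebesgue_on {0..t}. exp (- lam n * (t - s)) * R s * coef D phi f n)
                     + W n \<omega>)
                (u t \<omega>))))"

definition forward_op ::
  "(real ^ 'd) set \<Rightarrow> (nat \<Rightarrow> real) \<Rightarrow> (nat \<Rightarrow> real ^ 'd \<Rightarrow> real) \<Rightarrow> real \<Rightarrow> (real \<Rightarrow> real) \<Rightarrow>
   (real ^ 'd \<Rightarrow> real) \<Rightarrow> real ^ 'd \<Rightarrow> real" where
  "forward_op D lam phi T R v =
     l2_series (lebesgue_on D) phi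
       (\<lambda>n. (LINT s|lebesgue_on {0..T}. exp (- lam n * (T - s)) * R s) * coef D phi v n)"

text \<open>Only the members of the family \<open>obs\<close> with index below \<open>k\<close> matter.\<close>

definition independent_copies ::
  "'w measure \<Rightarrow> (real ^ 'd) set \<Rightarrow> nat \<Rightarrow> ('w \<Rightarrow> real ^ 'd \<Rightarrow> real) \<Rightarrow>
   (nat \<Rightarrow> 'w \<Rightarrow> real ^ 'd \<Rightarrow> real) \<Rightarrow> bool" where
  "independent_copies M D k X obs \<longleftrightarrow>
     prob_space.indep_vars M (\<lambda>_. L2_borel (lebesgue_on D)) obs {..<k} \<and>
     (\<forall>i<k. distr M (L2_borel (lebesgue_on D)) (obs i) = distr M (L2_borel (lebesgue_on D)) X)"

definition sample_mean ::
  "nat \<Rightarrow> (nat \<Rightarrow> 'w \<Rightarrow> real ^ 'd \<Rightarrow> real) \<Rightarrow> 'w \<Rightarrow> real ^ 'd \<Rightarrow> real" where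
  "sample_mean N obs \<omega> x = 1 / (real N)\<^sup>2 * (\<Sum>i<N\<^sup>2. obs i \<omega> x)"

definition noisy_data ::
  "(real ^ 'd) set \<Rightarrow> (nat \<Rightarrow> real) \<Rightarrow> (nat \<Rightarrow> real ^ 'd \<Rightarrow> real) \<Rightarrow> real \<Rightarrow> (real ^ 'd \<Rightarrow> real) \<Rightarrow>
   nat \<Rightarrow> (nat \<Rightarrow> 'w \<Rightarrow> real ^ 'd \<Rightarrow> real) \<Rightarrow> 'w \<Rightarrow> real ^ 'd \<Rightarrow> real" where
  "noisy_data D lam phi T u0 N obs \<omega> x =
     sample_mean N obs \<omega> x
     - l2_series (lebesgue_on D) phi (\<lambda>n. exp (- lam n * T) * coef D phi u0 n) x"

definition tikhonov ::
  "(real ^ 'd) set \<Rightarrow> (nat \<Rightarrow> real) \<Rightarrow> (nat \<Rightarrow> real ^ 'd \<Rightarrow> real) \<Rightarrow> real \<Rightarrow> (real \<Rightarrow> real) \<Rightarrow>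
   (real ^ 'd \<Rightarrow> real) \<Rightarrow> (real ^ 'd \<Rightarrow> real) \<Rightarrow> real \<Rightarrow> (real ^ 'd \<Rightarrow> real) \<Rightarrow> real" where
  "tikhonov D lam phi T R hdat f0 \<gamma> v =
     1 / 2 * (l2_norm (lebesgue_on D) (\<lambda>x. forward_op D lam phi T R v x - hdat x))\<^sup>2
     + \<gamma> / 2 * (l2_norm (lebesgue_on D) (\<lambda>x. v x - f0 x))\<^sup>2"

definition noise_level :: "(real ^ 'd) set \<Rightarrow> (nat \<Rightarrow> real) \<Rightarrow> (real ^ 'd \<Rightarrow> real) \<Rightarrow> nat \<Rightarrow> real" where
  "noise_level D lam g N = sqrt (1 / (2 * lam 0)) / real N * l2_norm (lebesgue_on D) g"

end

theory Submission
  imports Defs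
begin

text \<open>
  Everything diagonalises in the eigenbasis. With \<open>G\<^sub>n = \<integral>\<^sub>0\<^sup>T e\<^bsup>-\<lambda>\<^sub>n(T-s)\<^esup> R(s) ds\<close> and
  \<open>e\<^sub>n\<close> the \<open>n\<close>-th coefficient of the averaged noise, the minimiser of the Tikhonov functional
  satisfies \<open>(f - f\<^sub>\<gamma>)\<^sub>n = (\<gamma> (f - f\<^sup>0)\<^sub>n - G\<^sub>n e\<^sub>n) / (G\<^sub>n\<^sup>2 + \<gamma>)\<close>.
  Since \<open>G\<^sub>n \<ge> C\<^sub>R C\<^sub>0 / \<lambda>\<^sub>n\<close> and \<open>G\<^sub>n\<^sup>2 + \<gamma> \<ge> 2 G\<^sub>n \<surd>\<gamma>\<close>, the square of the right-hand side is at most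
  \<open>2 \<gamma>\<^sup>2 \<lambda>\<^sub>n\<^sup>4 (f - f\<^sup>0)\<^sub>n\<^sup>2 / (C\<^sub>R C\<^sub>0)\<^sup>4 + e\<^sub>n\<^sup>2 / (2\<gamma>)\<close>.
  By the Ito isometry and independence of the \<open>N\<^sup>2\<close> observations, the second moment of \<open>e\<^sub>n\<close> is at most
  \<open>g\<^sub>n\<^sup>2 / (2 \<lambda>\<^sub>1 N\<^sup>2)\<close>, and these bounds sum to \<open>\<delta>\<^sup>2\<close>. The choice of \<open>\<gamma>\<close> balances the two terms.
  Any positive \<open>C\<^sub>1\<close> works, for instance \<open>1\<close>.
\<close>

section \<open>The seminormed space of square-integrable functions\<close>

lemma L2_measurable: "v \<in> L2 M \<Longrightarrow> v \<in> borel_measurable M"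
  by (simp add: L2_def)

lemma L2_integrable_mult:
  assumes "u \<in> L2 M" "v \<in> L2 M"
  shows "integrable M (\<lambda>x. u x * v x)"
proof (rule Bochner_Integration.integrable_bound)
  show "integrable M (\<lambda>x. (u x)\<^sup>2 + (v x)\<^sup>2)"
    using assms by (auto simp: L2_def)
  show "(\<lambda>x. u x * v x) \<in> borel_measurable M"
    using assms by (auto simp: L2_def)
  have "\<bar>a * b\<bar> \<le> a\<^sup>2 + b\<^sup>2" for a b :: real
    using sum_squares_bound[of "\<bar>a\<bar>" "\<bar>b\<bar>"] mult_nonneg_nonneg[of "\<bar>a\<bar>" "\<bar>b\<bar>"]
    by (simp only: abs_mult power2_abs) linarith
  then show "AE x in M. norm (u x * v x) \<le> norm ((u x)\<^sup>2 + (v x)\<^sup>2)"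
    by simp
qed

lemma L2_add: "u \<in> L2 M \<Longrightarrow> v \<in> L2 M \<Longrightarrow> (\<lambda>x. u x + v x) \<in> L2 M"
  using L2_integrable_mult[of u M v]
  by (auto simp: L2_def power2_sum mult.assoc)

lemma L2_scale: "v \<in> L2 M \<Longrightarrow> (\<lambda>x. r * v x) \<in> L2 M"
  by (auto simp: L2_def power_mult_distrib)

lemma L2_diff: "u \<in> L2 M \<Longrightarrow> v \<in> L2 M \<Longrightarrow> (\<lambda>x. u x - v x) \<in> L2 M"
  using L2_add[of u M "\<lambda>x. -1 * v x"] L2_scale[of v M "-1"] by simp

lemma L2_zero: "(\<lambda>x. 0) \<in> L2 M"
  by (simp add: L2_def)

lemma L2_sum: "(\<And>i. i \<in> I \<Longrightarrow> v i \<in> L2 M) \<Longrightarrow> (\<lambda>x. \<Sum>i\<in>I. v i x) \<in> L2 M"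
  by (induction I rule: infinite_finite_induct) (auto simp: L2_zero intro: L2_add)

section \<open>Bilinearity and orthogonality of the inner product\<close>

lemma l2_inner_commute: "l2_inner M u v = l2_inner M v u"
  by (simp add: l2_inner_def mult.commute)

lemma l2_inner_add_left:
  "u \<in> L2 M \<Longrightarrow> v \<in> L2 M \<Longrightarrow> z \<in> L2 M \<Longrightarrow>
    l2_inner M (\<lambda>x. u x + v x) z = l2_inner M u z + l2_inner M v z"
  by (simp add: l2_inner_def distrib_right L2_integrable_mult)

lemma l2_inner_diff_left:
  "u \<in> L2 M \<Longrightarrow> v \<in> L2 M \<Longrightarrow> z \<in> L2 M \<Longrightarrow>
    l2_inner M (\<lambda>x. u x - v x) z = l2_inner M u z - l2_inner M v z"
  by (simp add: l2_inner_def left_diff_distrib L2_integrable_mult)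

lemma l2_inner_scale_left: "l2_inner M (\<lambda>x. r * u x) z = r * l2_inner M u z"
  by (simp add: l2_inner_def mult.assoc)

lemma l2_inner_sum_left:
  "(\<And>i. i \<in> I \<Longrightarrow> v i \<in> L2 M) \<Longrightarrow> z \<in> L2 M \<Longrightarrow>
    l2_inner M (\<lambda>x. \<Sum>i\<in>I. v i x) z = (\<Sum>i\<in>I. l2_inner M (v i) z)"
  by (simp add: l2_inner_def sum_distrib_right L2_integrable_mult)

lemma l2_inner_diff_right:
  "u \<in> L2 M \<Longrightarrow> v \<in> L2 M \<Longrightarrow> z \<in> L2 M \<Longrightarrow>
    l2_inner M z (\<lambda>x. u x - v x) = l2_inner M z u - l2_inner M z v"
  by (simp add: l2_inner_def right_diff_distrib L2_integrable_mult)

lemma l2_inner_scale_right: "l2_inner M z (\<lambda>x. r * u x) = r * l2_inner M z u"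
  by (simp add: l2_inner_def mult.left_commute)

lemma l2_inner_sum_right:
  "(\<And>i. i \<in> I \<Longrightarrow> v i \<in> L2 M) \<Longrightarrow> z \<in> L2 M \<Longrightarrow>
    l2_inner M z (\<lambda>x. \<Sum>i\<in>I. v i x) = (\<Sum>i\<in>I. l2_inner M z (v i))"
  by (simp add: l2_inner_def sum_distrib_left L2_integrable_mult)

lemma l2_inner_self_nonneg: "0 \<le> l2_inner M v v"
  by (simp add: l2_inner_def)

lemma l2_norm_nonneg: "0 \<le> l2_norm M v"
  by (simp add: l2_norm_def l2_inner_self_nonneg)

lemma l2_norm_square: "(l2_norm M v)\<^sup>2 = l2_inner M v v"
  by (simp add: l2_norm_def l2_inner_self_nonneg)

lemma nn_integral_square_L2:
  assumes "v \<in> L2 M"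
  shows "(\<integral>\<^sup>+x. ennreal ((v x)\<^sup>2) \<partial>M) = ennreal ((l2_norm M v)\<^sup>2)"
proof -
  have "integrable M (\<lambda>x. (v x)\<^sup>2)"
    using assms by (simp add: L2_def)
  from nn_integral_eq_integral[OF this] show ?thesis
    by (simp add: l2_norm_square l2_inner_def flip: power2_eq_square)
qed

lemma l2_inner_diff_self:
  assumes "u \<in> L2 M" "v \<in> L2 M"
  shows "l2_inner M (\<lambda>x. u x - v x) (\<lambda>x. u x - v x)
    = l2_inner M u u - 2 * l2_inner M u v + l2_inner M v v"
  using assms
  by (simp add: l2_inner_diff_left l2_inner_diff_right L2_diff l2_inner_commute[of M v u])

lemma l2_inner_sum_orthogonal:
  assumes "finite I" "\<And>i. i \<in> I \<Longrightarrow> v i \<in> L2 M"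
    and orth: "\<And>i j. i \<in> I \<Longrightarrow> j \<in> I \<Longrightarrow> i \<noteq> j \<Longrightarrow> l2_inner M (v i) (v j) = 0"
  shows "l2_inner M (\<lambda>x. \<Sum>i\<in>I. v i x) (\<lambda>x. \<Sum>i\<in>I. v i x) = (\<Sum>i\<in>I. l2_inner M (v i) (v i))"
proof -
  have "l2_inner M (v i) (\<lambda>x. \<Sum>j\<in>I. v j x) = l2_inner M (v i) (v i)" if "i \<in> I" for i
  proof -
    have "l2_inner M (v i) (\<lambda>x. \<Sum>j\<in>I. v j x) = (\<Sum>j\<in>I. l2_inner M (v i) (v j))"
      using assms that by (simp add: l2_inner_sum_right)
    also have "\<dots> = (\<Sum>j\<in>I. if j = i then l2_inner M (v i) (v i) else 0)"
      using that by (intro sum.cong) (auto simp: orth)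
    finally show ?thesis
      using that \<open>finite I\<close> by simp
  qed
  then show ?thesis
    using assms by (simp add: l2_inner_sum_left L2_sum)
qed

text \<open>The squared norm of \<open>t * u - v\<close> is a nonnegative polynomial in
  \<open>t\<close>. Its leading coefficient \<open>p\<close> may vanish, so the affine case is split
  off.\<close>

lemma l2_cauchy_schwarz:
  assumes "u \<in> L2 M" "v \<in> L2 M"
  shows "\<bar>l2_inner M u v\<bar> \<le> l2_norm M u * l2_norm M v"
proof -
  define p q r where "p = l2_inner M u u" and "q = l2_inner M u v" and "r = l2_inner M v v"
  have quad: "0 \<le> t\<^sup>2 * p - 2 * t * q + r" for t
  proof -
    have "0 \<le> l2_inner M (\<lambda>x. t * u x - v x) (\<lambda>x. t * u x - v x)"
      by (rule l2_inner_self_nonneg)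
    also have "\<dots> = t * (t * p) - 2 * (t * q) + r"
      using assms
      by (simp add: l2_inner_diff_self L2_scale l2_inner_scale_left l2_inner_scale_right
          p_def q_def r_def)
    finally show ?thesis
      by (simp add: power2_eq_square mult.assoc)
  qed
  have "q\<^sup>2 \<le> p * r"
  proof (cases "p = 0")
    case True
    have "q = 0"
    proof (rule ccontr)
      assume "q \<noteq> 0"
      \<comment> \<open>At this argument the affine function \<open>r - 2 * t * q\<close> takes the
        value -1.\<close>
      with quad[of "(r + 1) / (2 * q)"] True show False
        by (simp add: field_simps)
    qed
    with True show ?thesis by simp
  next
    case False
    then have "p > 0"
      using l2_inner_self_nonneg[of M u] by (simp add: p_def)
    \<comment> \<open>The quadratic has its minimum at \<open>q / p\<close>, with value
      \<open>r - q\<^sup>2 / p\<close>.\<close>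
    with quad[of "q / p"] show ?thesis
      by (simp add: field_simps power2_eq_square)
  qed
  then have "sqrt (q\<^sup>2) \<le> sqrt (p * r)"
    by (rule real_sqrt_le_mono)
  then show ?thesis
    by (simp add: l2_norm_def real_sqrt_mult p_def q_def r_def)
qed

lemma l2_norm_diff_commute: "l2_norm M (\<lambda>x. u x - v x) = l2_norm M (\<lambda>x. v x - u x)"
proof -
  have "(u x - v x) * (u x - v x) = (v x - u x) * (v x - u x)" for x
    using power2_commute[of "u x" "v x"] by (simp only: power2_eq_square)
  then show ?thesis
    by (simp only: l2_norm_def l2_inner_def)
qed

lemma l2_norm_triangle_diff:
  assumes "u \<in> L2 M" "v \<in> L2 M"
  shows "\<bar>l2_norm M u - l2_norm M v\<bar> \<le> l2_norm M (\<lambda>x. u x - v x)"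
proof -
  have "(l2_norm M u - l2_norm M v)\<^sup>2 \<le> (l2_norm M (\<lambda>x. u x - v x))\<^sup>2"
    using l2_cauchy_schwarz[OF assms] assms
    by (simp add: power2_diff l2_norm_square l2_inner_diff_self)
  then show ?thesis
    by (rule abs_le_square_iff[THEN iffD2, THEN order_trans]) (simp add: l2_norm_nonneg)
qed

text \<open>Cauchy-Schwarz makes the pairing with \<open>z\<close> Lipschitz. A basis function as
  \<open>z\<close> yields coefficients of limits, the constant 1 yields means.\<close>

lemma l2_inner_tendsto:
  assumes "\<And>n. X n \<in> L2 M" "Y \<in> L2 M" "z \<in> L2 M"
    and lim: "(\<lambda>n. l2_norm M (\<lambda>x. X n x - Y x)) \<longlonglongrightarrow> 0"
  shows "(\<lambda>n. l2_inner M (X n) z) \<longlonglongrightarrow> l2_inner M Y z"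
proof (rule LIM_zero_cancel, rule Lim_null_comparison)
  have "norm (l2_inner M (X n) z - l2_inner M Y z) \<le> l2_norm M (\<lambda>x. X n x - Y x) * l2_norm M z" for n
    using l2_cauchy_schwarz[OF L2_diff[OF assms(1,2)] assms(3), of n]
    by (simp add: l2_inner_diff_left assms)
  then show "\<forall>\<^sub>F n in sequentially. norm (l2_inner M (X n) z - l2_inner M Y z)
      \<le> l2_norm M (\<lambda>x. X n x - Y x) * l2_norm M z"
    by simp
  show "(\<lambda>n. l2_norm M (\<lambda>x. X n x - Y x) * l2_norm M z) \<longlonglongrightarrow> 0"
    using tendsto_mult[OF lim tendsto_const] by simp
qed

text \<open>The norm is 1-Lipschitz by the reverse triangle inequality. This carries both Parseval's
  identity and the Ito isometry to the limit.\<close>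

lemma l2_inner_self_tendsto:
  assumes "\<And>n. X n \<in> L2 M" "Y \<in> L2 M"
    and lim: "(\<lambda>n. l2_norm M (\<lambda>x. X n x - Y x)) \<longlonglongrightarrow> 0"
  shows "(\<lambda>n. l2_inner M (X n) (X n)) \<longlonglongrightarrow> l2_inner M Y Y"
proof -
  have "(\<lambda>n. l2_norm M (X n)) \<longlonglongrightarrow> l2_norm M Y"
  proof (rule LIM_zero_cancel, rule Lim_null_comparison[OF _ lim])
    show "\<forall>\<^sub>F n in sequentially. norm (l2_norm M (X n) - l2_norm M Y)
        \<le> l2_norm M (\<lambda>x. X n x - Y x)"
      using assms by (simp add: l2_norm_triangle_diff)
  qed
  then have "(\<lambda>n. (l2_norm M (X n))\<^sup>2) \<longlonglongrightarrow> (l2_norm M Y)\<^sup>2"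
    by (rule tendsto_power)
  then show ?thesis
    by (simp add: l2_norm_square)
qed

text \<open>A subsequence with geometrically small gaps converges almost everywhere, and Fatou's
  lemma upgrades the pointwise limit to a mean-square limit. The Cauchy condition concerns squared
  norms, the form in which orthonormal partial sums are computed.\<close>

lemma L2_complete:
  assumes S: "\<And>n. S n \<in> L2 M"
    and cauchy: "\<And>e. e > 0 \<Longrightarrow> \<exists>N. \<forall>m\<ge>N. \<forall>n\<ge>N. (l2_norm M (\<lambda>x. S m x - S n x))\<^sup>2 \<le> e"
  shows "\<exists>v\<in>L2 M. (\<lambda>n. l2_norm M (\<lambda>x. v x - S n x)) \<longlonglongrightarrow> 0"
proof -
  note [measurable] = L2_measurable[OF S]
  have nn: "(\<integral>\<^sup>+x. ennreal ((S m x - S n x)\<^sup>2) \<partial>M) = ennreal ((l2_norm M (\<lambda>x. S m x - S n x))\<^sup>2)" for m n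
    by (rule nn_integral_square_L2) (intro L2_diff S)
  \<comment> \<open>The rate 1/8 leaves the summable \<open>(1/2)^k\<close> after multiplication by
    the weight \<open>4^k\<close> used below.\<close>
  have "\<forall>k. \<exists>N. \<forall>m\<ge>N. \<forall>n\<ge>N. (l2_norm M (\<lambda>x. S m x - S n x))\<^sup>2 \<le> (1/8)^k"
    using cauchy by simp
  then obtain N where N: "\<And>k m n. m \<ge> N k \<Longrightarrow> n \<ge> N k \<Longrightarrow> (l2_norm M (\<lambda>x. S m x - S n x))\<^sup>2 \<le> (1/8)^k"
    by metis
  \<comment> \<open>Summing the thresholds puts \<open>r k\<close> beyond every \<open>N j\<close>
    with \<open>j \<le> k\<close>, so \<open>r k\<close> and \<open>r (Suc k)\<close> both exceed
    \<open>N k\<close>.\<close>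
  define r where "r k = (\<Sum>j\<le>k. N j)" for k
  have r_ge: "N j \<le> r k" if "j \<le> k" for j k
    unfolding r_def using that by (intro member_le_sum) auto
  define d where "d k x = S (r (Suc k)) x - S (r k) x" for k x
  have [measurable]: "d k \<in> borel_measurable M" for k
    unfolding d_def by measurable
  \<comment> \<open>The weights \<open>4\<^sup>k\<close> make \<open>d k x\<close> decay geometrically in \<open>k\<close> for almost every \<open>x\<close>, so that
    no triangle inequality in \<open>L\<^sup>2\<close> is needed.\<close>
  have "(\<integral>\<^sup>+x. (\<Sum>k. ennreal (4^k * (d k x)\<^sup>2)) \<partial>M) = (\<Sum>k. \<integral>\<^sup>+x. ennreal (4^k * (d k x)\<^sup>2) \<partial>M)"
    by (intro nn_integral_suminf) measurable
  also have "\<dots> \<le> (\<Sum>k. ennreal ((1/2)^k))"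
  proof (intro suminf_le)
    fix k
    have "(\<integral>\<^sup>+x. ennreal (4^k * (d k x)\<^sup>2) \<partial>M) = ennreal (4^k) * (\<integral>\<^sup>+x. ennreal ((d k x)\<^sup>2) \<partial>M)"
      by (subst nn_integral_cmult[symmetric]) (auto simp: ennreal_mult)
    also have "\<dots> \<le> ennreal (4^k) * ennreal ((1/8)^k)"
      using N[of k "r (Suc k)" "r k"] r_ge[of k k] r_ge[of k "Suc k"]
      by (intro mult_left_mono) (auto simp: d_def nn intro!: ennreal_leI)
    also have "\<dots> = ennreal ((1/2)^k)"
      by (subst ennreal_mult[symmetric]) (simp_all flip: power_mult_distrib)
    finally show "(\<integral>\<^sup>+x. ennreal (4^k * (d k x)\<^sup>2) \<partial>M) \<le> ennreal ((1/2)^k)" .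
  qed auto
  also have "\<dots> < \<infinity>"
    by (subst suminf_ennreal2) (auto intro: summable_geometric)
  finally have "AE x in M. (\<Sum>k. ennreal (4^k * (d k x)\<^sup>2)) \<noteq> \<infinity>"
    by (intro nn_integral_PInf_AE) auto
  \<comment> \<open>Where the subsequence diverges, \<open>lim\<close> is a fixed unspecified value;
    this concerns only a null set and keeps \<open>v\<close> measurable.\<close>
  define v where "v x = lim (\<lambda>k. S (r k) x)" for x
  have [measurable]: "v \<in> borel_measurable M"
    unfolding v_def by measurable
  have lim: "AE x in M. (\<lambda>k. S (r k) x) \<longlonglongrightarrow> v x"
    using \<open>AE x in M. (\<Sum>k. ennreal (4^k * (d k x)\<^sup>2)) \<noteq> \<infinity>\<close>
  proof eventually_elim
    case (elim x)
    then have "summable (\<lambda>k. 4^k * (d k x)\<^sup>2)"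
      by (intro summable_suminf_not_top) auto
    then have "Bseq (\<lambda>k. 4^k * (d k x)\<^sup>2)"
      by (intro convergent_imp_Bseq) (auto simp: convergent_def dest: summable_LIMSEQ_zero)
    then obtain B where B: "B > 0" "\<And>k. norm (4^k * (d k x)\<^sup>2) \<le> B"
      by (auto simp: Bseq_def)
    have "summable (\<lambda>k. d k x)"
    proof (rule summable_comparison_test'[where N = 0])
      show "summable (\<lambda>k. sqrt B * (1/2)^k)"
        by (intro summable_mult summable_geometric) auto
      fix k :: nat
      have "((2::real)^k)\<^sup>2 = 4^k"
        by (simp add: power2_eq_square flip: power_mult_distrib)
      then have "(2^k * d k x)\<^sup>2 \<le> B"
        using B(2)[of k] by (simp add: power_mult_distrib)
      then have "2^k * \<bar>d k x\<bar> \<le> sqrt B"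
        using real_le_rsqrt[of "2^k * \<bar>d k x\<bar>" B] by (simp add: power_mult_distrib)
      then show "norm (d k x) \<le> sqrt B * (1/2)^k"
        by (simp add: field_simps)
    qed
    then have "convergent (\<lambda>n. S (r n) x - S (r 0) x)"
      unfolding summable_iff_convergent d_def sum_lessThan_telescope[of "\<lambda>n. S (r n) x"] .
    then have "convergent (\<lambda>n. S (r n) x)"
      by (simp add: convergent_diff_const_right_iff)
    then show ?case
      by (simp add: v_def convergent_LIMSEQ_iff)
  qed
  have fatou: "(\<integral>\<^sup>+x. ennreal ((v x - S n x)\<^sup>2) \<partial>M) \<le> ennreal ((1/8)^j)" if "N j \<le> n" for n j
  proof -
    have "(\<integral>\<^sup>+x. ennreal ((v x - S n x)\<^sup>2) \<partial>M)
        = (\<integral>\<^sup>+x. liminf (\<lambda>k. ennreal ((S (r k) x - S n x)\<^sup>2)) \<partial>M)"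
      using lim
    proof (intro nn_integral_cong_AE, eventually_elim)
      case (elim x)
      then have "(\<lambda>k. ennreal ((S (r k) x - S n x)\<^sup>2)) \<longlonglongrightarrow> ennreal ((v x - S n x)\<^sup>2)"
        by (intro tendsto_intros)
      then show ?case
        by (simp only: lim_imp_Liminf[OF sequentially_bot])
    qed
    also have "\<dots> \<le> liminf (\<lambda>k. \<integral>\<^sup>+x. ennreal ((S (r k) x - S n x)\<^sup>2) \<partial>M)"
      by (intro nn_integral_liminf) measurable
    \<comment> \<open>The Cauchy bound holds for all \<open>k \<ge> j\<close>, hence for the limsup,
      which dominates the liminf from Fatou.\<close>
    also have "\<dots> \<le> limsup (\<lambda>k. \<integral>\<^sup>+x. ennreal ((S (r k) x - S n x)\<^sup>2) \<partial>M)"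
      by (intro Liminf_le_Limsup) simp
    also have "\<dots> \<le> ennreal ((1/8)^j)"
      by (rule Limsup_bounded, rule eventually_sequentiallyI[of j])
        (use that in \<open>auto simp: nn intro!: ennreal_leI N r_ge\<close>)
    finally show ?thesis .
  qed
  have diff: "(\<lambda>x. v x - S n x) \<in> L2 M" if "N j \<le> n" for n j
    using fatou[OF that] order.strict_trans1[OF fatou[OF that] ennreal_less_top]
    by (auto simp: L2_def integrable_iff_bounded)
  then have "(\<lambda>x. (v x - S (N 0) x) + S (N 0) x) \<in> L2 M"
    using S by (intro L2_add) auto
  then have "v \<in> L2 M"
    by simp
  moreover have "(\<lambda>n. (l2_norm M (\<lambda>x. v x - S n x))\<^sup>2) \<longlonglongrightarrow> 0"
  proof (rule LIMSEQ_I)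
    fix e :: real
    assume "e > 0"
    then obtain j where j: "(1/8::real)^j < e"
      using real_arch_pow_inv[of e "1/8"] by auto
    have "(l2_norm M (\<lambda>x. v x - S n x))\<^sup>2 \<le> (1/8)^j" if "N j \<le> n" for n
    proof -
      have "(\<integral>\<^sup>+x. ennreal ((v x - S n x)\<^sup>2) \<partial>M) = ennreal ((l2_norm M (\<lambda>x. v x - S n x))\<^sup>2)"
        using diff[OF that] by (rule nn_integral_square_L2)
      with fatou[OF that] show ?thesis
        by (simp only: ennreal_le_iff zero_le_power zero_le_divide_1_iff zero_le_numeral)
    qed
    with j show "\<exists>no. \<forall>n\<ge>no. norm ((l2_norm M (\<lambda>x. v x - S n x))\<^sup>2 - 0) < e"
      by (auto intro!: exI[of _ "N j"] intro: order.strict_trans1)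
  qed
  then have "(\<lambda>n. l2_norm M (\<lambda>x. v x - S n x)) \<longlonglongrightarrow> 0"
    using tendsto_real_sqrt by (fastforce simp: l2_norm_nonneg)
  ultimately show ?thesis
    by blast
qed

section \<open>Expansions in an orthonormal basis\<close>

lemma orthonormal_basis_L2: "orthonormal_basis M phi \<Longrightarrow> phi n \<in> L2 M"
  by (simp add: orthonormal_basis_def)

lemma orthonormal_basis_inner:
  "orthonormal_basis M phi \<Longrightarrow> l2_inner M (phi m) (phi n) = (if m = n then 1 else 0)"
  by (simp add: orthonormal_basis_def)

lemma orthonormal_sum_L2:
  "orthonormal_basis M phi \<Longrightarrow> (\<lambda>x. \<Sum>k\<in>I. b k * phi k x) \<in> L2 M"
  by (intro L2_sum L2_scale orthonormal_basis_L2)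

lemma orthonormal_sum_norm:
  assumes "orthonormal_basis M phi" "finite I"
  shows "l2_inner M (\<lambda>x. \<Sum>k\<in>I. b k * phi k x) (\<lambda>x. \<Sum>k\<in>I. b k * phi k x) = (\<Sum>k\<in>I. (b k)\<^sup>2)"
  using assms
  by (subst l2_inner_sum_orthogonal)
    (auto simp: L2_scale orthonormal_basis_L2 l2_inner_scale_left l2_inner_scale_right
      orthonormal_basis_inner power2_eq_square)

lemma l2_sums_tendsto:
  "l2_sums M phi b v \<Longrightarrow> (\<lambda>n. l2_norm M (\<lambda>x. (\<Sum>k<n. b k * phi k x) - v x)) \<longlonglongrightarrow> 0"
  by (simp add: l2_sums_def l2_norm_diff_commute[of M _ v])

lemma l2_sums_coef:
  assumes basis: "orthonormal_basis M phi" and sums: "l2_sums M phi b v"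
  shows "l2_inner M v (phi n) = b n"
proof -
  have "(\<lambda>m. l2_inner M (\<lambda>x. \<Sum>k<m. b k * phi k x) (phi n)) \<longlonglongrightarrow> l2_inner M v (phi n)"
    using sums
    by (intro l2_inner_tendsto l2_sums_tendsto orthonormal_sum_L2[OF basis] orthonormal_basis_L2[OF basis])
      (auto simp: l2_sums_def)
  moreover have "(\<lambda>m. l2_inner M (\<lambda>x. \<Sum>k<m. b k * phi k x) (phi n)) \<longlonglongrightarrow> b n"
  \<comment> \<open>The coefficient is exactly \<open>b n\<close> once \<open>n\<close> lies in
    \<open>{..<m}\<close>, that is from \<open>m = Suc n\<close> on.\<close>
  proof (rule tendsto_eventually, rule eventually_sequentiallyI[of "Suc n"])
    fix m assume "Suc n \<le> m"
    have "l2_inner M (\<lambda>x. \<Sum>k<m. b k * phi k x) (phi n) = (\<Sum>k<m. if k = n then b k else 0)"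
      by (subst l2_inner_sum_left)
        (auto simp: L2_scale orthonormal_basis_L2[OF basis] l2_inner_scale_left
          orthonormal_basis_inner[OF basis] mult_delta_right)
    then show "l2_inner M (\<lambda>x. \<Sum>k<m. b k * phi k x) (phi n) = b n"
      using \<open>Suc n \<le> m\<close> by simp
  qed
  ultimately show ?thesis
    by (rule LIMSEQ_unique)
qed

text \<open>Pythagoras for the partial sums, then continuity of the norm.\<close>

lemma parseval:
  assumes basis: "orthonormal_basis M phi" and v: "v \<in> L2 M"
  shows "(\<lambda>n. (l2_inner M v (phi n))\<^sup>2) sums l2_inner M v v"
proof -
  have "l2_sums M phi (\<lambda>n. l2_inner M v (phi n)) v"
    using assms by (simp add: orthonormal_basis_def)
  from l2_inner_self_tendsto[OF orthonormal_sum_L2[OF basis] v l2_sums_tendsto[OF this]]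
  show ?thesis
    by (simp add: orthonormal_sum_norm[OF basis] sums_def)
qed

text \<open>Since \<open>l2_series\<close> is defined by choice, it carries information only once a
  sum is known to exist. Pythagoras turns square summability into the Cauchy property of the partial
  sums.\<close>

lemma riesz_fischer:
  assumes basis: "orthonormal_basis M phi" and "summable (\<lambda>n. (b n)\<^sup>2)"
  shows "\<exists>v. l2_sums M phi b v"
proof -
  define S where "S n x = (\<Sum>k<n. b k * phi k x)" for n x
  have S: "S n \<in> L2 M" for n
    unfolding S_def by (rule orthonormal_sum_L2[OF basis])
  have norm: "(l2_norm M (\<lambda>x. S n x - S m x))\<^sup>2 = (\<Sum>k=m..<n. (b k)\<^sup>2)" if "m \<le> n" for m n
  proof -
    have "S n x - S m x = (\<Sum>k=m..<n. b k * phi k x)" for x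
      using that sum_diff_nat_ivl[of 0 m n "\<lambda>k. b k * phi k x"]
      by (simp add: S_def lessThan_atLeast0)
    then show ?thesis
      by (simp add: l2_norm_square orthonormal_sum_norm[OF basis])
  qed
  have "\<exists>N. \<forall>m\<ge>N. \<forall>n\<ge>N. (l2_norm M (\<lambda>x. S m x - S n x))\<^sup>2 \<le> e" if "e > 0" for e
  proof -
    obtain N where N: "\<And>m n. m \<ge> N \<Longrightarrow> norm (\<Sum>k=m..<n. (b k)\<^sup>2) < e"
      using assms(2) \<open>e > 0\<close> unfolding summable_Cauchy by blast
    have le: "(l2_norm M (\<lambda>x. S n x - S m x))\<^sup>2 \<le> e" if "m \<ge> N" "m \<le> n" for m n
      using N[OF that(1), of n] by (simp add: norm[OF that(2)])
    have "(l2_norm M (\<lambda>x. S m x - S n x))\<^sup>2 \<le> e" if "m \<ge> N" "n \<ge> N" for m n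
      using le[of m n] le[of n m] that l2_norm_diff_commute[of M "S m" "S n"]
      by (cases "m \<le> n") auto
    then show ?thesis
      by blast
  qed
  from L2_complete[OF S this] show ?thesis
    by (auto simp: l2_sums_def S_def)
qed

lemma l2_series_coef:
  assumes "orthonormal_basis M phi" "summable (\<lambda>n. (b n)\<^sup>2)"
  shows "l2_series M phi b \<in> L2 M" and "l2_inner M (l2_series M phi b) (phi n) = b n"
proof -
  have "l2_sums M phi b (l2_series M phi b)"
    unfolding l2_series_def using riesz_fischer[OF assms] by (rule someI_ex)
  then show "l2_series M phi b \<in> L2 M" "l2_inner M (l2_series M phi b) (phi n) = b n"
    using l2_sums_coef[OF assms(1)] by (auto simp: l2_sums_def)
qed

lemma space_L2_borel: "space (L2_borel M) = L2 M"
  unfolding L2_borel_def by (rule space_measure_of) (auto simp: l2_open_def)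

text \<open>By Cauchy-Schwarz, preimages of open sets are open in the seminorm topology.
  Coefficients of random functions thereby become real random variables, to which laws and
  independence pass.\<close>

lemma l2_inner_measurable:
  assumes z: "z \<in> L2 M"
  shows "(\<lambda>v. l2_inner M v z) \<in> borel_measurable (L2_borel M)"
proof (rule borel_measurableI)
  fix S :: "real set"
  assume "open S"
  have "l2_open M ((\<lambda>v. l2_inner M v z) -` S \<inter> L2 M)"
    unfolding l2_open_def
  proof (intro conjI ballI)
    fix u assume u: "u \<in> (\<lambda>v. l2_inner M v z) -` S \<inter> L2 M"
    then obtain e where e: "e > 0" "\<And>y. dist y (l2_inner M u z) < e \<Longrightarrow> y \<in> S"
      using \<open>open S\<close> unfolding open_dist by blast
    \<comment> \<open>The added 1 keeps the radius below meaningful when \<open>z\<close> has norm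
      zero.\<close>
    have pos: "l2_norm M z + 1 > 0"
      using l2_norm_nonneg[of M z] by simp
    show "\<exists>e>0. \<forall>v\<in>L2 M. l2_norm M (\<lambda>x. v x - u x) < e \<longrightarrow> v \<in> (\<lambda>v. l2_inner M v z) -` S \<inter> L2 M"
    proof (intro exI[of _ "e / (l2_norm M z + 1)"] conjI ballI impI)
      fix v assume v: "v \<in> L2 M" and less: "l2_norm M (\<lambda>x. v x - u x) < e / (l2_norm M z + 1)"
      have "\<bar>l2_inner M v z - l2_inner M u z\<bar> \<le> l2_norm M (\<lambda>x. v x - u x) * l2_norm M z"
        using l2_cauchy_schwarz[of "\<lambda>x. v x - u x" M z] u v z
        by (simp add: l2_inner_diff_left L2_diff)
      also have "\<dots> \<le> l2_norm M (\<lambda>x. v x - u x) * (l2_norm M z + 1)"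
        by (intro mult_left_mono) (auto simp: l2_norm_nonneg)
      also have "\<dots> < e"
        using less pos by (simp add: field_simps)
      finally show "v \<in> (\<lambda>v. l2_inner M v z) -` S \<inter> L2 M"
        using v e(2) by (simp add: dist_real_def)
    qed (use e(1) pos in simp)
  qed auto
  then show "(\<lambda>v. l2_inner M v z) -` S \<inter> space (L2_borel M) \<in> sets (L2_borel M)"
    unfolding space_L2_borel unfolding L2_borel_def by (intro in_measure_of) (auto simp: l2_open_def)
qed

section \<open>The Ito isometry for deterministic integrands\<close>

lemma lebesgue_integral_exp:
  fixes l T :: real
  assumes "l > 0" "T \<ge> 0"
  shows "(LINT s|lebesgue_on {0..T}. exp (- l * (T - s))) = (1 - exp (- l * T)) / l"
proof -
  have "((\<lambda>s. exp (- l * (T - s))) has_integral exp (- l * (T - T)) / l - exp (- l * (T - 0)) / l) {0..T}"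
    using assms
    by (intro fundamental_theorem_of_calculus)
      (auto intro!: derivative_eq_intros simp flip: has_real_derivative_iff_has_vector_derivative)
  moreover have "integrable (lebesgue_on {0..T}) (\<lambda>s. exp (- l * (T - s)))"
    by (intro continuous_imp_integrable_real continuous_intros)
  ultimately show ?thesis
    by (simp add: lebesgue_integral_eq_integral integral_unique diff_divide_distrib)
qed

lemma brownian_increment_moments:
  assumes "brownian_motion M F w" "prob_space M" "0 \<le> s" "s \<le> t"
  shows "(\<lambda>\<omega>. w t \<omega> - w s \<omega>) \<in> L2 M"
    and "(LINT \<omega>|M. w t \<omega> - w s \<omega>) = 0"
    and "l2_inner M (\<lambda>\<omega>. w t \<omega> - w s \<omega>) (\<lambda>\<omega>. w t \<omega> - w s \<omega>) = t - s"
proof -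
  let ?X = "\<lambda>\<omega>. w t \<omega> - w s \<omega>"
  have "?X \<in> L2 M \<and> (LINT \<omega>|M. ?X \<omega>) = 0 \<and> l2_inner M ?X ?X = t - s"
  \<comment> \<open>Brownian increments are given a law only for \<open>s < t\<close>, while step
    functions may have repeated nodes.\<close>
  proof (cases "s = t")
    case True
    then show ?thesis
      by (simp add: L2_zero l2_inner_def)
  next
    case False
    with assms have pos: "0 < sqrt (t - s)"
      by simp
    have dist: "distributed M lborel ?X (normal_density 0 (sqrt (t - s)))"
      using assms False by (simp add: brownian_motion_def)
    have "integrable M (\<lambda>\<omega>. (?X \<omega>)\<^sup>2)"
      using distributed_integrable[OF dist, of "\<lambda>x. x\<^sup>2"] integrable_normal_moment[OF pos, of 0 2]
      by simp
    moreover have "?X \<in> borel_measurable M"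
      using distributed_measurable[OF dist] by simp
    moreover have "(LINT \<omega>|M. ?X \<omega>) = 0"
      using distributed_integral[OF dist, of "\<lambda>x. x"] integral_normal_moment_nz_1[OF pos, of 0]
      by simp
    moreover have "(LINT \<omega>|M. (?X \<omega>)\<^sup>2) = t - s"
      using distributed_integral[OF dist, of "\<lambda>x. x\<^sup>2"] integral_normal_moment_even[OF pos, of 0 1] pos
      by simp
    ultimately show ?thesis
      by (simp add: L2_def l2_inner_def power2_eq_square)
  qed
  then show "?X \<in> L2 M" "(LINT \<omega>|M. ?X \<omega>) = 0" "l2_inner M ?X ?X = t - s"
    by auto
qed

text \<open>The earlier increment is measurable at time \<open>s\<close>; the later one is centred
  and independent of \<open>F s\<close>. Hence the mean of the product factors and vanishes.\<close>

lemma brownian_increments_orthogonal: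
  assumes filt: "complete_filtered_prob_space M F" and bm: "brownian_motion M F w"
    and times: "0 \<le> a" "a \<le> b" "b \<le> s" "s \<le> t"
  shows "l2_inner M (\<lambda>\<omega>. w b \<omega> - w a \<omega>) (\<lambda>\<omega>. w t \<omega> - w s \<omega>) = 0"
proof (cases "s = t")
  case True
  then show ?thesis
    by (simp add: l2_inner_def)
next
  case False
  interpret prob_space M
    using filt by (simp add: complete_filtered_prob_space_def)
  let ?X = "\<lambda>\<omega>. w b \<omega> - w a \<omega>" and ?Y = "\<lambda>\<omega>. w t \<omega> - w s \<omega>"
  note X = brownian_increment_moments[OF bm prob_space_axioms times(1,2)]
  have "0 \<le> s"
    using times by simp
  note Y = brownian_increment_moments[OF bm prob_space_axioms this times(4)]
  have space: "space (F s) = space M"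
    using filt \<open>0 \<le> s\<close> by (simp add: complete_filtered_prob_space_def subalgebra_def)
  have adapted: "w r \<in> borel_measurable (F s)" if "0 \<le> r" "r \<le> s" for r
  proof (rule measurable_from_subalg)
    show "w r \<in> borel_measurable (F r)"
      using bm that by (simp add: brownian_motion_def)
    show "subalgebra (F s) (F r)"
      using filt that \<open>0 \<le> s\<close> by (simp add: complete_filtered_prob_space_def subalgebra_def)
  qed
  have XF: "?X \<in> borel_measurable (F s)"
    using times by (intro borel_measurable_diff adapted) auto
  have "indep_var borel ?X borel ?Y"
    unfolding indep_var_eq
  proof (intro conjI)
    have "indep_set (sets (F s)) {?Y -` B \<inter> space M | B. B \<in> sets borel}"
      using bm \<open>0 \<le> s\<close> times False by (simp add: brownian_motion_def)
    then show "indep_set (sigma_sets (space M) {?X -` A \<inter> space M | A. A \<in> sets borel})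
        (sigma_sets (space M) {?Y -` A \<inter> space M | A. A \<in> sets borel})"
      unfolding indep_set_def
    proof (rule indep_sets_mono_sets, goal_cases)
      case (1 i)
      have "sigma_sets (space M) {?X -` A \<inter> space M | A. A \<in> sets borel} \<subseteq> sets (F s)"
        unfolding space[symmetric]
        by (intro sets.sigma_sets_subset) (auto intro: measurable_sets[OF XF])
      \<comment> \<open>The Borel preimages under the later increment already form a
        sigma-algebra.\<close>
      moreover have "sigma_sets (space M) {?Y -` A \<inter> space M | A. A \<in> sets borel}
          = {?Y -` A \<inter> space M | A. A \<in> sets borel}"
        using sets_vimage_algebra2[of ?Y "space M" borel] by (simp add: sets_vimage_algebra)
      ultimately show ?case
        by (cases i) auto
    qed
  qed (use X(1) Y(1) in \<open>auto simp: L2_def\<close>)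
  \<comment> \<open>On a probability space the constant 1 is square integrable, so multiplying by it
    gives integrability.\<close>
  moreover have "integrable M Z" if "Z \<in> L2 M" for Z
    using L2_integrable_mult[OF that, of "\<lambda>_. 1"] by (simp add: L2_def)
  ultimately show ?thesis
    using indep_var_lebesgue_integral[of ?X ?Y] X Y by (simp add: l2_inner_def)
qed

lemma nondecreasing_up_to:
  fixes s :: "nat \<Rightarrow> real"
  assumes "\<And>k. k < m \<Longrightarrow> s k \<le> s (Suc k)" "i \<le> j" "j \<le> m"
  shows "s i \<le> s j"
  using assms(2,3)
proof (induction j rule: dec_induct)
  case (step n)
  then show ?case
    using assms(1)[of n] by simp
qed simp

text \<open>Successive increments are centred and orthogonal, so no cross terms survive. The
  resulting sum reappears in \<open>step_fun_norm\<close>; together the two lemmas are the Ito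
  isometry for step functions.\<close>

lemma step_integral_moments:
  assumes filt: "complete_filtered_prob_space M F" and bm: "brownian_motion M F w"
    and nonneg: "\<And>k. k \<le> m \<Longrightarrow> 0 \<le> s k" and mono: "\<And>k. k < m \<Longrightarrow> s k \<le> s (Suc k)"
  shows "step_integral w m s b \<in> L2 M"
    and "(LINT \<omega>|M. step_integral w m s b \<omega>) = 0"
    and "l2_inner M (step_integral w m s b) (step_integral w m s b)
      = (\<Sum>k<m. (b k)\<^sup>2 * (s (Suc k) - s k))"
proof -
  interpret prob_space M
    using filt by (simp add: complete_filtered_prob_space_def)
  define Y where "Y k \<omega> = b k * (w (s (Suc k)) \<omega> - w (s k) \<omega>)" for k \<omega>
  have eq: "step_integral w m s b = (\<lambda>\<omega>. \<Sum>k<m. Y k \<omega>)"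
    by (simp add: step_integral_def Y_def fun_eq_iff)
  note incr = brownian_increment_moments[OF bm prob_space_axioms nonneg mono]
  have L2: "Y k \<in> L2 M" if "k < m" for k
    unfolding Y_def using that by (intro L2_scale incr) auto
  have int: "integrable M Z" if "Z \<in> L2 M" for Z
    using L2_integrable_mult[OF that, of "\<lambda>_. 1"] by (simp add: L2_def)
  have mean: "(LINT \<omega>|M. Y k \<omega>) = 0" if "k < m" for k
    unfolding Y_def using that by (simp add: incr(2))
  have s_le: "s i \<le> s j" if "i \<le> j" "j \<le> m" for i j
    using nondecreasing_up_to[of m s i j] mono that by blast
  have less: "l2_inner M (Y j) (Y k) = 0" if "j < k" "k < m" for j k
    unfolding Y_def l2_inner_scale_left l2_inner_scale_right using that
    by (subst brownian_increments_orthogonal[OF filt bm])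
      (auto intro!: nonneg s_le)
  have orth: "l2_inner M (Y j) (Y k) = 0" if "j < m" "k < m" "j \<noteq> k" for j k
    using less[of j k] less[of k j] that l2_inner_commute[of M "Y j" "Y k"] by (cases "j < k") auto
  show "step_integral w m s b \<in> L2 M"
    unfolding eq by (intro L2_sum) (auto intro: L2)
  show "(LINT \<omega>|M. step_integral w m s b \<omega>) = 0"
    unfolding eq by (subst Bochner_Integration.integral_sum) (auto intro: int L2 simp: mean)
  have "l2_inner M (step_integral w m s b) (step_integral w m s b) = (\<Sum>k<m. l2_inner M (Y k) (Y k))"
    unfolding eq by (intro l2_inner_sum_orthogonal) (auto intro: L2 orth)
  also have "\<dots> = (\<Sum>k<m. (b k)\<^sup>2 * (s (Suc k) - s k))"
    by (intro sum.cong)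
      (auto simp: Y_def[abs_def] l2_inner_scale_left l2_inner_scale_right incr(3) power2_eq_square)
  finally show "l2_inner M (step_integral w m s b) (step_integral w m s b)
      = (\<Sum>k<m. (b k)\<^sup>2 * (s (Suc k) - s k))" .
qed

lemma step_fun_norm:
  assumes range: "\<And>k. k \<le> m \<Longrightarrow> s k \<in> {0..t}" and mono: "\<And>k. k < m \<Longrightarrow> s k \<le> s (Suc k)"
  shows "step_fun m s b \<in> L2 (lebesgue_on {0..t})"
    and "l2_inner (lebesgue_on {0..t}) (step_fun m s b) (step_fun m s b)
      = (\<Sum>k<m. (b k)\<^sup>2 * (s (Suc k) - s k))"
proof -
  let ?L = "lebesgue_on {0..t}"
  define Y where "Y k r = b k * indicator {s k<..s (Suc k)} r" for k and r :: real
  have eq: "step_fun m s b = (\<lambda>r. \<Sum>k<m. Y k r)"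
    by (simp add: step_fun_def Y_def fun_eq_iff)
  have sub: "{s k<..s (Suc k)} \<subseteq> {0..t}" if "k < m" for k
    using range[of k] range[of "Suc k"] that by auto
  then have sets: "{s k<..s (Suc k)} \<in> sets ?L" if "k < m" for k
    using that by (auto simp: sets_restrict_space_iff)
  have measure: "measure ?L {s k<..s (Suc k)} = s (Suc k) - s k" if "k < m" for k
    using sub[OF that] mono[OF that] by (simp add: measure_restrict_space)
  have fin: "emeasure ?L {s k<..s (Suc k)} < \<infinity>" if "k < m" for k
    using sub[OF that] mono[OF that] by (simp add: emeasure_restrict_space)
  have square: "(indicator A r :: real)\<^sup>2 = indicator A r" for A and r :: real
    by (simp add: indicator_def)
  have L2: "Y k \<in> L2 ?L" if "k < m" for k
    unfolding Y_def using sets[OF that] fin[OF that]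
    by (intro L2_scale) (auto simp: L2_def square)
  have norm: "l2_inner ?L (Y k) (Y k) = (b k)\<^sup>2 * (s (Suc k) - s k)" if "k < m" for k
    unfolding Y_def l2_inner_scale_left l2_inner_scale_right using sets[OF that] measure[OF that]
    by (simp add: l2_inner_def Int_absorb2[OF sub[OF that]] power2_eq_square flip: indicator_inter_arith)
  \<comment> \<open>Half-open intervals do not meet even at a shared node.\<close>
  have less: "Y j r * Y k r = 0" if "j < k" "k < m" for j k r
    using nondecreasing_up_to[of m s "Suc j" k] mono that
    by (auto simp: Y_def indicator_def)
  have disjoint: "Y j r * Y k r = 0" if "j < m" "k < m" "j \<noteq> k" for j k r
    using less[of j k r] less[of k j r] that by (cases "j < k") (auto simp: mult.commute)
  have orth: "l2_inner ?L (Y j) (Y k) = 0" if "j < m" "k < m" "j \<noteq> k" for j k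
    unfolding l2_inner_def disjoint[OF that] by simp
  show "step_fun m s b \<in> L2 ?L"
    unfolding eq by (intro L2_sum) (auto intro: L2)
  show "l2_inner ?L (step_fun m s b) (step_fun m s b) = (\<Sum>k<m. (b k)\<^sup>2 * (s (Suc k) - s k))"
    unfolding eq by (subst l2_inner_sum_orthogonal) (auto intro: L2 orth simp: norm)
qed

text \<open>Mean and second moment pass to the limit along the step functions supplied by the
  definition of the integral.\<close>

lemma wiener_integral_moments:
  assumes filt: "complete_filtered_prob_space M F" and bm: "brownian_motion M F w"
    and wiener: "has_wiener_integral M w t \<eta> I"
  shows "(LINT \<omega>|M. I \<omega>) = 0" and "l2_inner M I I = l2_inner (lebesgue_on {0..t}) \<eta> \<eta>"
proof -
  interpret prob_space M
    using filt by (simp add: complete_filtered_prob_space_def)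
  obtain m s b where range: "\<And>n k. k \<le> m n \<Longrightarrow> s n k \<in> {0..t}"
    and mono: "\<And>n k. k < m n \<Longrightarrow> s n k \<le> s n (Suc k)"
    and lim_fun: "(\<lambda>n. l2_norm (lebesgue_on {0..t}) (\<lambda>r. step_fun (m n) (s n) (b n) r - \<eta> r)) \<longlonglongrightarrow> 0"
    and lim_int: "(\<lambda>n. l2_norm M (\<lambda>\<omega>. step_integral w (m n) (s n) (b n) \<omega> - I \<omega>)) \<longlonglongrightarrow> 0"
    using wiener unfolding has_wiener_integral_def by blast
  have L2: "\<eta> \<in> L2 (lebesgue_on {0..t})" "I \<in> L2 M"
    using wiener by (auto simp: has_wiener_integral_def)
  have nonneg: "0 \<le> s n k" if "k \<le> m n" for n k
    using range[OF that] by simp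
  note int = step_integral_moments[where m = "m n" and s = "s n" and b = "b n" for n, OF filt bm nonneg mono]
    and step = step_fun_norm[where m = "m n" and s = "s n" and b = "b n" for n, OF range mono]
  \<comment> \<open>The mean is the inner product with the constant 1.\<close>
  have "(\<lambda>n. l2_inner M (step_integral w (m n) (s n) (b n)) (\<lambda>_. 1)) \<longlonglongrightarrow> l2_inner M I (\<lambda>_. 1)"
    by (rule l2_inner_tendsto[OF int(1) L2(2) _ lim_int]) (auto simp: L2_def)
  then show "(LINT \<omega>|M. I \<omega>) = 0"
    by (simp add: l2_inner_def int(2) LIMSEQ_const_iff)
  have "(\<lambda>n. l2_inner M (step_integral w (m n) (s n) (b n)) (step_integral w (m n) (s n) (b n)))
      \<longlonglongrightarrow> l2_inner M I I"
    by (rule l2_inner_self_tendsto[OF int(1) L2(2) lim_int])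
  moreover have "(\<lambda>n. l2_inner (lebesgue_on {0..t}) (step_fun (m n) (s n) (b n)) (step_fun (m n) (s n) (b n)))
      \<longlonglongrightarrow> l2_inner (lebesgue_on {0..t}) \<eta> \<eta>"
    by (rule l2_inner_self_tendsto[OF step(1) L2(1) lim_fun])
  ultimately show "l2_inner M I I = l2_inner (lebesgue_on {0..t}) \<eta> \<eta>"
    by (simp add: int(3) step(2) LIMSEQ_unique)
qed

section \<open>Tikhonov regularisation in coefficients\<close>

text \<open>Ensures convergence of the series for the forward operator and for the evolved initial
  value.\<close>

lemma summable_multiplier:
  assumes basis: "orthonormal_basis M phi" and bound: "\<And>n. \<bar>G n\<bar> \<le> B" and v: "v \<in> L2 M"
  shows "summable (\<lambda>n. (G n * l2_inner M v (phi n))\<^sup>2)"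
proof (rule summable_comparison_test'[where N = 0])
  show "summable (\<lambda>n. B\<^sup>2 * (l2_inner M v (phi n))\<^sup>2)"
    using parseval[OF basis v] by (intro summable_mult) (rule sums_summable)
  show "norm ((G n * l2_inner M v (phi n))\<^sup>2) \<le> B\<^sup>2 * (l2_inner M v (phi n))\<^sup>2" for n
    using power_mono[OF bound[of n] abs_ge_zero, of 2]
    by (simp add: power_mult_distrib mult_right_mono)
qed

text \<open>Parseval splits the functional into one quadratic per coefficient of \<open>v\<close>.
  Varying \<open>v\<close> along \<open>phi n\<close> alone isolates the n-th quadratic, whose
  vertex is the stated quotient.\<close>

lemma tikhonov_minimizer_coef:
  assumes basis: "orthonormal_basis M phi" and bound: "\<And>n. \<bar>G n\<bar> \<le> B"
    and d: "d \<in> L2 M" and f0: "f0 \<in> L2 M" and "\<gamma> > 0"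
    and min: "is_arg_min (\<lambda>v. 1 / 2 * (l2_norm M (\<lambda>x.
          l2_series M phi (\<lambda>n. G n * l2_inner M v (phi n)) x - d x))\<^sup>2
        + \<gamma> / 2 * (l2_norm M (\<lambda>x. v x - f0 x))\<^sup>2) (\<lambda>v. v \<in> L2 M) v"
  shows "l2_inner M v (phi n)
    = (G n * l2_inner M d (phi n) + \<gamma> * l2_inner M f0 (phi n)) / ((G n)\<^sup>2 + \<gamma>)"
proof -
  let ?c = "\<lambda>v k. l2_inner M v (phi k)"
  let ?K = "\<lambda>v. l2_series M phi (\<lambda>k. G k * ?c v k)"
  let ?J = "\<lambda>v. 1 / 2 * (l2_norm M (\<lambda>x. ?K v x - d x))\<^sup>2 + \<gamma> / 2 * (l2_norm M (\<lambda>x. v x - f0 x))\<^sup>2"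
  have phi: "phi k \<in> L2 M" for k
    by (rule orthonormal_basis_L2[OF basis])
  have J: "(\<lambda>k. 1 / 2 * (G k * ?c v k - ?c d k)\<^sup>2 + \<gamma> / 2 * (?c v k - ?c f0 k)\<^sup>2) sums ?J v"
    if v: "v \<in> L2 M" for v
  proof -
    note K = l2_series_coef[OF basis summable_multiplier[of M phi G B, OF basis bound v]]
    have "(\<lambda>k. 1 / 2 * (?c (\<lambda>x. ?K v x - d x) k)\<^sup>2 + \<gamma> / 2 * (?c (\<lambda>x. v x - f0 x) k)\<^sup>2) sums ?J v"
      unfolding l2_norm_square
      by (intro sums_add sums_mult parseval[OF basis] L2_diff K(1) d v f0)
    then show ?thesis
      by (simp add: l2_inner_diff_left K d v f0 phi)
  qed
  have v: "v \<in> L2 M" and le: "\<And>z. z \<in> L2 M \<Longrightarrow> ?J v \<le> ?J z"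
    using min by (auto simp: is_arg_min_linorder)
  \<comment> \<open>\<open>t * Q + t\<^sup>2 * P\<close> is the change of the functional in passing from \<open>v\<close> to \<open>v + t \<phi>\<^sub>n\<close>, so
    minimality forces \<open>Q = 0\<close>.\<close>
  define P Q where "P = ((G n)\<^sup>2 + \<gamma>) / 2" and "Q = G n * (G n * ?c v n - ?c d n) + \<gamma> * (?c v n - ?c f0 n)"
  have "0 \<le> t * Q + t\<^sup>2 * P" for t
  proof -
    let ?z = "\<lambda>x. v x + t * phi n x"
    have z: "?z \<in> L2 M"
      by (intro L2_add L2_scale v phi)
    have cz: "?c ?z k = ?c v k + (if k = n then t else 0)" for k
      using v phi
      by (auto simp: l2_inner_add_left L2_scale l2_inner_scale_left orthonormal_basis_inner[OF basis])
    have "(\<lambda>k. if k = n then t * Q + t\<^sup>2 * P else 0) sums (?J ?z - ?J v)"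
    proof (rule sums_cong[THEN iffD1, OF _ sums_diff[OF J[OF z] J[OF v]]])
      fix k
      show "1 / 2 * (G k * ?c ?z k - ?c d k)\<^sup>2 + \<gamma> / 2 * (?c ?z k - ?c f0 k)\<^sup>2
          - (1 / 2 * (G k * ?c v k - ?c d k)\<^sup>2 + \<gamma> / 2 * (?c v k - ?c f0 k)\<^sup>2)
        = (if k = n then t * Q + t\<^sup>2 * P else 0)"
        unfolding cz by (simp add: P_def Q_def power2_eq_square field_simps)
    qed
    then have "?J ?z - ?J v = t * Q + t\<^sup>2 * P"
      using sums_single[of n "\<lambda>_. t * Q + t\<^sup>2 * P"] sums_unique2 by blast
    then show ?thesis
      using le[OF z] by simp
  qed
  moreover have "P > 0"
    using \<open>\<gamma> > 0\<close> by (simp add: P_def add_nonneg_pos)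
  \<comment> \<open>The quadratic in \<open>t\<close> is smallest at
    \<open>t = - Q / (2 * P)\<close>; nonnegativity there forces \<open>Q = 0\<close>.\<close>
  moreover have "- Q / (2 * P) * Q + (- Q / (2 * P))\<^sup>2 * P = - (Q\<^sup>2 / (4 * P))"
    using \<open>P > 0\<close> by (simp add: power2_eq_square field_simps)
  ultimately have "0 \<le> - (Q\<^sup>2 / (4 * P))"
    by metis
  then have "Q = 0"
    using \<open>P > 0\<close> by (simp add: divide_le_0_iff)
  moreover have "(G n)\<^sup>2 + \<gamma> \<noteq> 0"
    using \<open>P > 0\<close> by (simp add: P_def)
  ultimately show ?thesis
    by (simp add: Q_def power2_eq_square field_simps)
qed

text \<open>Bias and noise are separated by
  \<open>(x - y)\<^sup>2 \<le> 2 * x\<^sup>2 + 2 * y\<^sup>2\<close>. The squared denominator is at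
  least \<open>q ^ 4\<close>, used for the bias, and at least
  \<open>4 * \<gamma> * G\<^sup>2\<close> by the arithmetic-geometric mean inequality, used for the
  noise.\<close>

lemma filter_error_bound:
  fixes G \<gamma> p e q :: real
  assumes "\<gamma> > 0" "q > 0" "q \<le> G"
  shows "((\<gamma> * p - G * e) / (G\<^sup>2 + \<gamma>))\<^sup>2 \<le> 2 * \<gamma>\<^sup>2 * p\<^sup>2 / q ^ 4 + e\<^sup>2 / (2 * \<gamma>)"
proof -
  define s where "s = G\<^sup>2 + \<gamma>"
  have "s > 0"
    using assms by (simp add: s_def add_nonneg_pos)
  have "q ^ 4 \<le> G ^ 4"
    using assms by (intro power_mono) auto
  also have "\<dots> = (G\<^sup>2)\<^sup>2"
    by simp
  also have "\<dots> \<le> s\<^sup>2"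
    using assms by (intro power_mono) (auto simp: s_def)
  finally have q: "q ^ 4 \<le> s\<^sup>2" .
  have "0 \<le> (G\<^sup>2 - \<gamma>)\<^sup>2"
    by simp
  then have G: "G\<^sup>2 * (4 * \<gamma>) \<le> s\<^sup>2"
    by (simp add: s_def power2_sum power2_diff ac_simps)
  \<comment> \<open>This square is exactly the difference of the two sides of the next
    inequality.\<close>
  have "0 \<le> (\<gamma> * p / s + G * e / s)\<^sup>2"
    by simp
  then have "((\<gamma> * p - G * e) / s)\<^sup>2 \<le> 2 * (\<gamma> * p / s)\<^sup>2 + 2 * (G * e / s)\<^sup>2"
    by (simp add: diff_divide_distrib power2_sum power2_diff)
  also have "\<dots> = 2 * \<gamma>\<^sup>2 * p\<^sup>2 / s\<^sup>2 + 2 * e\<^sup>2 * (G\<^sup>2 / s\<^sup>2)"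
    by (simp add: power_mult_distrib power_divide mult_ac)
  also have "\<dots> \<le> 2 * \<gamma>\<^sup>2 * p\<^sup>2 / q ^ 4 + 2 * e\<^sup>2 * (1 / (4 * \<gamma>))"
  proof (intro add_mono divide_left_mono mult_left_mono)
    show "G\<^sup>2 / s\<^sup>2 \<le> 1 / (4 * \<gamma>)"
      using G assms \<open>s > 0\<close> by (simp add: field_simps)
  qed (use q assms \<open>s > 0\<close> in auto)
  finally show ?thesis
    by (simp add: s_def)
qed

text \<open>\<open>R\<close> is compared with constants and the exponential is integrated. The upper
  bound makes the forward operator bounded; the lower one, for \<open>C > 0\<close>, limits the
  decay of its multipliers to order \<open>1 / l\<close>.\<close>

lemma multiplier_bounds:
  assumes R: "R \<in> Linfty (lebesgue_on {0..T})" and "T \<ge> 0"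
    and lower: "AE t in lebesgue_on {0..T}. C \<le> R t"
  shows "\<exists>B\<ge>0. \<forall>l>0. \<bar>LINT s|lebesgue_on {0..T}. exp (- l * (T - s)) * R s\<bar> \<le> B / l"
    and "l > 0 \<Longrightarrow> C * (1 - exp (- l * T)) / l \<le> (LINT s|lebesgue_on {0..T}. exp (- l * (T - s)) * R s)"
proof -
  let ?L = "lebesgue_on {0..T}"
  obtain B where B: "AE t in ?L. \<bar>R t\<bar> \<le> B"
    using R by (auto simp: Linfty_def)
  have exp_int: "integrable ?L (\<lambda>s. r * exp (- l * (T - s)))" for r l
    by (intro continuous_imp_integrable_real continuous_intros)
  have "(\<lambda>s. exp (- l * (T - s))) \<in> borel_measurable ?L" for l
    using exp_int[of 1 l] by simp
  then have meas: "(\<lambda>s. exp (- l * (T - s)) * R s) \<in> borel_measurable ?L" for l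
    using R by (auto simp: Linfty_def)
  have int: "integrable ?L (\<lambda>s. exp (- l * (T - s)) * R s)" for l
  proof (rule Bochner_Integration.integrable_bound[OF exp_int[of B l] meas])
    show "AE s in ?L. norm (exp (- l * (T - s)) * R s) \<le> norm (B * exp (- l * (T - s)))"
      using B by eventually_elim (auto simp: abs_mult)
  qed
  \<comment> \<open>For \<open>T = 0\<close> the interval is null and \<open>B\<close> may be
    negative, hence \<open>\<bar>B\<bar>\<close>.\<close>
  have upper: "\<bar>LINT s|?L. exp (- l * (T - s)) * R s\<bar> \<le> \<bar>B\<bar> / l" if "l > 0" for l
  proof -
    have "\<bar>LINT s|?L. exp (- l * (T - s)) * R s\<bar> \<le> (LINT s|?L. \<bar>exp (- l * (T - s)) * R s\<bar>)"
      by (rule integral_abs_bound)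
    also have "\<dots> \<le> (LINT s|?L. \<bar>B\<bar> * exp (- l * (T - s)))"
    proof (rule integral_mono_AE)
      show "AE s in ?L. \<bar>exp (- l * (T - s)) * R s\<bar> \<le> \<bar>B\<bar> * exp (- l * (T - s))"
        using B by eventually_elim (auto simp: abs_mult)
    qed (use int exp_int in auto)
    also have "\<dots> = \<bar>B\<bar> * ((1 - exp (- l * T)) / l)"
      using lebesgue_integral_exp[OF that \<open>T \<ge> 0\<close>] by simp
    also have "\<dots> \<le> \<bar>B\<bar> * (1 / l)"
      using that by (intro mult_left_mono divide_right_mono) auto
    finally show ?thesis
      by simp
  qed
  then show "\<exists>B\<ge>0. \<forall>l>0. \<bar>LINT s|?L. exp (- l * (T - s)) * R s\<bar> \<le> B / l"
    by (intro exI[of _ "\<bar>B\<bar>"]) auto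
  assume "l > 0"
  have "C * (1 - exp (- l * T)) / l = (LINT s|?L. C * exp (- l * (T - s)))"
    using lebesgue_integral_exp[OF \<open>l > 0\<close> \<open>T \<ge> 0\<close>] by simp
  also have "\<dots> \<le> (LINT s|?L. exp (- l * (T - s)) * R s)"
  proof (rule integral_mono_AE)
    show "AE s in ?L. C * exp (- l * (T - s)) \<le> exp (- l * (T - s)) * R s"
      using lower by eventually_elim (auto simp: mult.commute)
  qed (use int exp_int in auto)
  finally show "C * (1 - exp (- l * T)) / l \<le> (LINT s|?L. exp (- l * (T - s)) * R s)" .
qed

section \<open>The averaged observations and the error bound\<close>

text \<open>Independent centred variables are orthogonal, so the sum has second moment
  \<open>k * \<sigma>2\<close>; the prefactor contributes \<open>1 / k\<^sup>2\<close>. This is the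
  gain from repeated observation.\<close>

lemma (in prob_space) iid_average_second_moment:
  fixes Y :: "nat \<Rightarrow> 'a \<Rightarrow> real"
  assumes indep: "indep_vars (\<lambda>_. borel) Y {..<k}" and "k > 0"
    and L2: "\<And>i. i < k \<Longrightarrow> Y i \<in> L2 M" and mean: "\<And>i. i < k \<Longrightarrow> expectation (Y i) = 0"
    and var: "\<And>i. i < k \<Longrightarrow> l2_inner M (Y i) (Y i) = \<sigma>2"
  shows "l2_inner M (\<lambda>\<omega>. 1 / real k * (\<Sum>i<k. Y i \<omega>)) (\<lambda>\<omega>. 1 / real k * (\<Sum>i<k. Y i \<omega>)) = \<sigma>2 / real k"
proof -
  have int: "integrable M (Y i)" if "i < k" for i
    using L2_integrable_mult[OF L2[OF that], of "\<lambda>_. 1"] by (simp add: L2_def)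
  have "l2_inner M (Y i) (Y j) = 0" if "i < k" "j < k" "i \<noteq> j" for i j
  proof -
    have "indep_vars (\<lambda>_. borel) Y {i, j}"
      by (rule indep_vars_subset[OF indep]) (use that in auto)
    then have "expectation (\<lambda>\<omega>. \<Prod>l\<in>{i, j}. Y l \<omega>) = (\<Prod>l\<in>{i, j}. expectation (Y l))"
      by (intro indep_vars_lebesgue_integral) (use that in \<open>auto intro: int\<close>)
    then show ?thesis
      using that by (simp add: l2_inner_def mean)
  qed
  then have "l2_inner M (\<lambda>\<omega>. \<Sum>i<k. Y i \<omega>) (\<lambda>\<omega>. \<Sum>i<k. Y i \<omega>) = (\<Sum>i<k. l2_inner M (Y i) (Y i))"
    by (intro l2_inner_sum_orthogonal) (auto intro: L2)
  then show ?thesis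
    using \<open>k > 0\<close> by (simp only: l2_inner_scale_left l2_inner_scale_right) (simp add: var)
qed

text \<open>Each pair of quantities is one integral against the common law of \<open>X\<close> and
  \<open>Y\<close>. This carries moments of the terminal value over to every observation.\<close>

lemma coef_square_integrable_transfer:
  assumes copy: "distr M (L2_borel L) X = distr M (L2_borel L) Y"
    and X: "X \<in> measurable M (L2_borel L)" and Y: "Y \<in> measurable M (L2_borel L)"
    and q: "q \<in> borel_measurable (L2_borel L)" and L2: "(\<lambda>\<omega>. q (Y \<omega>)) \<in> L2 M"
  shows "(\<lambda>\<omega>. q (X \<omega>)) \<in> L2 M"
    and "(LINT \<omega>|M. q (X \<omega>)) = (LINT \<omega>|M. q (Y \<omega>))"
    and "l2_inner M (\<lambda>\<omega>. q (X \<omega>)) (\<lambda>\<omega>. q (X \<omega>)) = l2_inner M (\<lambda>\<omega>. q (Y \<omega>)) (\<lambda>\<omega>. q (Y \<omega>))"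
proof -
  have q2: "(\<lambda>v. (q v)\<^sup>2) \<in> borel_measurable (L2_borel L)"
    using q by measurable
  have "integrable M (\<lambda>\<omega>. (q (X \<omega>))\<^sup>2)"
    using L2 unfolding integrable_distr_eq[OF X q2, symmetric] copy integrable_distr_eq[OF Y q2]
    by (simp add: L2_def)
  then show "(\<lambda>\<omega>. q (X \<omega>)) \<in> L2 M"
    using measurable_compose[OF X q] by (simp add: L2_def)
  show "(LINT \<omega>|M. q (X \<omega>)) = (LINT \<omega>|M. q (Y \<omega>))"
    unfolding integral_distr[OF X q, symmetric] copy integral_distr[OF Y q] ..
  show "l2_inner M (\<lambda>\<omega>. q (X \<omega>)) (\<lambda>\<omega>. q (X \<omega>)) = l2_inner M (\<lambda>\<omega>. q (Y \<omega>)) (\<lambda>\<omega>. q (Y \<omega>))"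
    unfolding l2_inner_def power2_eq_square[symmetric]
      integral_distr[OF X q2, symmetric] copy integral_distr[OF Y q2] ..
qed

text \<open>\<open>q\<close> removes the deterministic part of the n-th coefficient. What remains is
  almost surely a Wiener integral, so the Ito isometry gives its second moment.\<close>

lemma mild_solution_coef_moments:
  assumes filt: "complete_filtered_prob_space M F" and bm: "brownian_motion M F w"
    and basis: "orthonormal_basis (lebesgue_on D) phi" and lam: "lam n > 0" and "T \<ge> 0"
    and mild: "mild_solution M w D lam phi T R u0 f g u"
  defines "q \<equiv> \<lambda>v. coef D phi v n - (exp (- lam n * T) * coef D phi u0 n
    + (LINT s|lebesgue_on {0..T}. exp (- lam n * (T - s)) * R s) * coef D phi f n)"
  shows "u T \<in> measurable M (L2_borel (lebesgue_on D))"
    and "q \<in> borel_measurable (L2_borel (lebesgue_on D))"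
    and "(\<lambda>\<omega>. q (u T \<omega>)) \<in> L2 M"
    and "(LINT \<omega>|M. q (u T \<omega>)) = 0"
    and "l2_inner M (\<lambda>\<omega>. q (u T \<omega>)) (\<lambda>\<omega>. q (u T \<omega>)) \<le> (coef D phi g n)\<^sup>2 / (2 * lam n)"
proof -
  let ?L = "lebesgue_on D"
  show u: "u T \<in> measurable M (L2_borel ?L)"
    using mild \<open>T \<ge> 0\<close> by (simp add: mild_solution_def)
  show q: "q \<in> borel_measurable (L2_borel ?L)"
    unfolding q_def
    by (intro borel_measurable_diff l2_inner_measurable orthonormal_basis_L2[OF basis]) simp
  obtain W where W: "\<And>n. has_wiener_integral M w T (\<lambda>s. exp (- lam n * (T - s)) * coef D phi g n) (W n)"
    and sums: "AE \<omega> in M. l2_sums ?L phi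
        (\<lambda>n. exp (- lam n * T) * coef D phi u0 n
             + (LINT s|lebesgue_on {0..T}. exp (- lam n * (T - s)) * R s * coef D phi f n) + W n \<omega>)
        (u T \<omega>)"
    using mild \<open>T \<ge> 0\<close> unfolding mild_solution_def by (auto dest!: bspec[of _ _ T])
  have AE: "AE \<omega> in M. q (u T \<omega>) = W n \<omega>"
    using sums by eventually_elim (simp add: q_def l2_sums_coef[OF basis])
  have WL2: "W n \<in> L2 M"
    using W by (simp add: has_wiener_integral_def)
  have meas [measurable]: "(\<lambda>\<omega>. q (u T \<omega>)) \<in> borel_measurable M" "W n \<in> borel_measurable M"
    using measurable_compose[OF u q] L2_measurable[OF WL2] by auto
  have AE2: "AE \<omega> in M. (q (u T \<omega>))\<^sup>2 = (W n \<omega>)\<^sup>2"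
    using AE by eventually_elim simp
  have "integrable M (\<lambda>\<omega>. (q (u T \<omega>))\<^sup>2) \<longleftrightarrow> integrable M (\<lambda>\<omega>. (W n \<omega>)\<^sup>2)"
    by (intro integrable_cong_AE AE2) measurable
  then show "(\<lambda>\<omega>. q (u T \<omega>)) \<in> L2 M"
    using WL2 by (simp add: L2_def)
  have "(LINT \<omega>|M. q (u T \<omega>)) = (LINT \<omega>|M. W n \<omega>)"
    by (intro integral_cong_AE AE) measurable
  then show "(LINT \<omega>|M. q (u T \<omega>)) = 0"
    by (simp add: wiener_integral_moments[OF filt bm W])
  have "l2_inner M (\<lambda>\<omega>. q (u T \<omega>)) (\<lambda>\<omega>. q (u T \<omega>)) = l2_inner M (W n) (W n)"
    unfolding l2_inner_def power2_eq_square[symmetric] by (intro integral_cong_AE AE2) measurable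
  also have "\<dots> = (LINT s|lebesgue_on {0..T}.
      exp (- lam n * (T - s)) * coef D phi g n * (exp (- lam n * (T - s)) * coef D phi g n))"
    using wiener_integral_moments(2)[OF filt bm W[of n]] by (simp only: l2_inner_def)
  \<comment> \<open>Squaring the kernel doubles the rate, which produces the 2 in
    \<open>1 / (2 * lam 0)\<close>.\<close>
  also have "\<dots> = (LINT s|lebesgue_on {0..T}. (coef D phi g n)\<^sup>2 * exp (- (2 * lam n) * (T - s)))"
    by (intro Bochner_Integration.integral_cong refl)
      (simp add: power2_eq_square algebra_simps flip: exp_add)
  also have "\<dots> = (coef D phi g n)\<^sup>2 * (LINT s|lebesgue_on {0..T}. exp (- (2 * lam n) * (T - s)))"
    by simp
  also have "\<dots> = (coef D phi g n)\<^sup>2 * ((1 - exp (- (2 * lam n) * T)) / (2 * lam n))"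
    using lebesgue_integral_exp[of "2 * lam n" T] lam \<open>T \<ge> 0\<close> by simp
  also have "\<dots> \<le> (coef D phi g n)\<^sup>2 * (1 / (2 * lam n))"
    using lam by (intro mult_left_mono divide_right_mono) auto
  finally show "l2_inner M (\<lambda>\<omega>. q (u T \<omega>)) (\<lambda>\<omega>. q (u T \<omega>)) \<le> (coef D phi g n)\<^sup>2 / (2 * lam n)"
    by simp
qed

text \<open>Valid for every positive \<open>\<gamma>\<close>; the parameter choice comes afterwards.
  Integrability is asserted as well because the integral of a non-integrable function is 0 by
  convention, which would make the bound empty.\<close>

lemma tikhonov_expected_error:
  assumes "T > 0" and filt: "complete_filtered_prob_space M F" and bm: "brownian_motion M F w"
    and basis: "orthonormal_basis (lebesgue_on D) phi" and "0 < lam 0" and "incseq lam"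
    and u0: "u0 \<in> L2 (lebesgue_on D)" and f: "f \<in> L2 (lebesgue_on D)" and g: "g \<in> L2 (lebesgue_on D)"
    and R: "R \<in> Linfty (lebesgue_on {0..T})"
    and "C_R > 0" and R_ge: "AE t in lebesgue_on {0..T}. C_R \<le> R t"
    and source: "(\<lambda>x. f x - f0 x) \<in> spectral_H2 D lam phi"
    and mild: "mild_solution M w D lam phi T R u0 f g u"
    and "N \<ge> 1" and copies: "independent_copies M D (N\<^sup>2) (u T) obs" and "\<gamma> > 0"
    and min: "\<And>\<omega>. \<omega> \<in> space M \<Longrightarrow>
      is_arg_min (tikhonov D lam phi T R (noisy_data D lam phi T u0 N obs \<omega>) f0 \<gamma>)
        (\<lambda>v. v \<in> L2 (lebesgue_on D)) (f\<delta> \<omega>)"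
  shows "integrable M (\<lambda>\<omega>. (l2_norm (lebesgue_on D) (\<lambda>x. f x - f\<delta> \<omega> x))\<^sup>2)"
    and "(LINT \<omega>|M. (l2_norm (lebesgue_on D) (\<lambda>x. f x - f\<delta> \<omega> x))\<^sup>2)
      \<le> 2 * \<gamma>\<^sup>2 * (spectral_H2_norm D lam phi (\<lambda>x. f x - f0 x))\<^sup>2 / (C_R * (1 - exp (- lam 0 * T))) ^ 4
        + (noise_level D lam g N)\<^sup>2 / (2 * \<gamma>)"
proof -
  interpret prob_space M
    using filt by (simp add: complete_filtered_prob_space_def)
  let ?L = "lebesgue_on D"
  let ?c = "coef D phi"

  \<comment> \<open>Spectral quantities and bounds on the multipliers\<close>
  define \<kappa> where "\<kappa> = C_R * (1 - exp (- lam 0 * T))"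
  define G where "G n = (LINT s|lebesgue_on {0..T}. exp (- lam n * (T - s)) * R s)" for n
  define q where "q n v = ?c v n - (exp (- lam n * T) * ?c u0 n + G n * ?c f n)" for n v
  \<comment> \<open>The n-th coefficient of the sample mean, centred at its expectation.\<close>
  define e where "e n \<omega> = 1 / real (N\<^sup>2) * (\<Sum>i<N\<^sup>2. q n (obs i \<omega>))" for n \<omega>
  define p where "p n = ?c (\<lambda>x. f x - f0 x) n" for n
  have phi: "phi n \<in> L2 ?L" for n
    by (rule orthonormal_basis_L2[OF basis])
  have lam_ge: "lam 0 \<le> lam n" for n
    using \<open>incseq lam\<close> by (simp add: incseq_def)
  have lam_pos: "lam n > 0" for n
    using \<open>0 < lam 0\<close> lam_ge by (rule order.strict_trans2)
  have "\<kappa> > 0"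
    using \<open>C_R > 0\<close> \<open>0 < lam 0\<close> \<open>T > 0\<close> by (simp add: \<kappa>_def)
  have G_ge: "\<kappa> / lam n \<le> G n" for n
  proof -
    have "\<kappa> \<le> C_R * (1 - exp (- lam n * T))"
      using \<open>C_R > 0\<close> \<open>T > 0\<close> lam_ge[of n] by (simp add: \<kappa>_def)
    then have "\<kappa> / lam n \<le> C_R * (1 - exp (- lam n * T)) / lam n"
      using lam_pos[of n] by (intro divide_right_mono) auto
    also have "\<dots> \<le> G n"
      using multiplier_bounds(2)[OF R _ R_ge lam_pos[of n]] \<open>T > 0\<close> by (simp add: G_def)
    finally show ?thesis .
  qed
  obtain B where "B \<ge> 0" and B: "\<And>l. l > 0 \<Longrightarrow> \<bar>LINT s|lebesgue_on {0..T}. exp (- l * (T - s)) * R s\<bar> \<le> B / l"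
    using multiplier_bounds(1)[OF R _ R_ge] \<open>T > 0\<close> by auto
  have G_bound: "\<bar>G n\<bar> \<le> B / lam 0" for n
  proof -
    have "\<bar>G n\<bar> \<le> B / lam n"
      using B[OF lam_pos[of n]] by (simp add: G_def)
    also have "\<dots> \<le> B / lam 0"
      using \<open>B \<ge> 0\<close> \<open>0 < lam 0\<close> lam_ge lam_pos[of n] by (intro divide_left_mono) auto
    finally show ?thesis .
  qed
  \<comment> \<open>\<open>f0\<close> is recovered as \<open>f\<close> minus the difference in the
    source condition.\<close>
  have f0: "f0 \<in> L2 ?L"
    using L2_diff[OF f, of "\<lambda>x. f x - f0 x"] source by (simp add: spectral_H2_def)

  \<comment> \<open>Second moments of the averaged noise\<close>
  have indep: "indep_vars (\<lambda>_. L2_borel ?L) obs {..<N\<^sup>2}"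
    and copy: "\<And>i. i < N\<^sup>2 \<Longrightarrow> distr M (L2_borel ?L) (obs i) = distr M (L2_borel ?L) (u T)"
    using copies by (auto simp: independent_copies_def)
  have obs: "obs i \<in> measurable M (L2_borel ?L)" if "i < N\<^sup>2" for i
    using indep that by (simp add: indep_vars_def)
  have obs_L2: "obs i \<omega> \<in> L2 ?L" if "i < N\<^sup>2" "\<omega> \<in> space M" for i \<omega>
    using measurable_space[OF obs[OF that(1)] that(2)] by (simp add: space_L2_borel)
  note terminal = mild_solution_coef_moments[OF filt bm basis lam_pos less_imp_le[OF \<open>T > 0\<close>] mild,
      folded G_def, folded q_def]
  note transfer = coef_square_integrable_transfer[OF copy obs terminal(1-3)]
  have e_L2: "e n \<in> L2 M" for n
    unfolding e_def[abs_def] by (intro L2_scale L2_sum) (auto intro: transfer(1))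
  have e_var: "(LINT \<omega>|M. (e n \<omega>)\<^sup>2) \<le> (?c g n)\<^sup>2 / (2 * lam 0 * real (N\<^sup>2))" for n
  proof -
    have "l2_inner M (e n) (e n)
        = l2_inner M (\<lambda>\<omega>. q n (u T \<omega>)) (\<lambda>\<omega>. q n (u T \<omega>)) / real (N\<^sup>2)"
      unfolding e_def[abs_def]
    proof (rule iid_average_second_moment)
      show "indep_vars (\<lambda>_. borel) (\<lambda>i \<omega>. q n (obs i \<omega>)) {..<N\<^sup>2}"
        by (rule indep_vars_compose2[OF indep]) (rule terminal(2))
    qed (use \<open>N \<ge> 1\<close> transfer terminal(4) in auto)
    also have "\<dots> \<le> ((?c g n)\<^sup>2 / (2 * lam n)) / real (N\<^sup>2)"
      by (intro divide_right_mono terminal(5)) simp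
    \<comment> \<open>The smallest eigenvalue gives a bound uniform in \<open>n\<close>, matching
      the constant inside \<open>noise_level\<close>.\<close>
    also have "\<dots> \<le> ((?c g n)\<^sup>2 / (2 * lam 0)) / real (N\<^sup>2)"
      using lam_ge[of n] \<open>0 < lam 0\<close> lam_pos[of n]
      by (intro divide_right_mono divide_left_mono) auto
    finally show ?thesis
      by (simp add: l2_inner_def power2_eq_square)
  qed

  \<comment> \<open>Coefficients of the data and of the minimiser\<close>
  have u0_sum: "summable (\<lambda>n. (exp (- lam n * T) * ?c u0 n)\<^sup>2)"
  proof (rule summable_multiplier[OF basis _ u0])
    show "\<bar>exp (- lam n * T)\<bar> \<le> 1" for n
      using lam_pos[of n] \<open>T > 0\<close> by simp
  qed
  note u0_series = l2_series_coef[OF basis u0_sum]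
  have data_L2: "noisy_data D lam phi T u0 N obs \<omega> \<in> L2 ?L" if "\<omega> \<in> space M" for \<omega>
    unfolding noisy_data_def[abs_def] sample_mean_def using that
    by (intro L2_diff L2_scale L2_sum u0_series) (auto intro: obs_L2)
  have data_coef: "?c (noisy_data D lam phi T u0 N obs \<omega>) n = G n * ?c f n + e n \<omega>"
    if "\<omega> \<in> space M" for \<omega> n
  proof -
    have avg: "(\<lambda>x. 1 / (real N)\<^sup>2 * (\<Sum>i<N\<^sup>2. obs i \<omega> x)) \<in> L2 ?L"
      using that by (intro L2_scale L2_sum) (auto intro: obs_L2)
    have "?c (noisy_data D lam phi T u0 N obs \<omega>) n
        = ?c (\<lambda>x. 1 / (real N)\<^sup>2 * (\<Sum>i<N\<^sup>2. obs i \<omega> x)) n - exp (- lam n * T) * ?c u0 n"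
      using l2_inner_diff_left[OF avg u0_series(1) phi, of n]
      by (simp only: noisy_data_def[abs_def] sample_mean_def u0_series(2))
    also have "?c (\<lambda>x. 1 / (real N)\<^sup>2 * (\<Sum>i<N\<^sup>2. obs i \<omega> x)) n
        = 1 / (real N)\<^sup>2 * (\<Sum>i<N\<^sup>2. ?c (obs i \<omega>) n)"
      using that by (subst l2_inner_scale_left, subst l2_inner_sum_left) (auto intro: obs_L2 phi)
    finally have "?c (noisy_data D lam phi T u0 N obs \<omega>) n
        = 1 / (real N)\<^sup>2 * (\<Sum>i<N\<^sup>2. ?c (obs i \<omega>) n) - exp (- lam n * T) * ?c u0 n" .
    then show ?thesis
      using \<open>N \<ge> 1\<close> by (simp add: e_def q_def sum_subtractf field_simps)
  qed
  have f\<delta>_L2: "f\<delta> \<omega> \<in> L2 ?L" if "\<omega> \<in> space M" for \<omega>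
    using min[OF that] by (simp add: is_arg_min_def)
  have f\<delta>_coef: "?c (f\<delta> \<omega>) n = (G n * (G n * ?c f n + e n \<omega>) + \<gamma> * ?c f0 n) / ((G n)\<^sup>2 + \<gamma>)"
    if "\<omega> \<in> space M" for \<omega> n
    unfolding data_coef[OF that, symmetric]
    by (rule tikhonov_minimizer_coef[OF basis G_bound data_L2[OF that] f0 \<open>\<gamma> > 0\<close>])
      (use min[OF that] in \<open>simp add: tikhonov_def[abs_def] forward_op_def G_def\<close>)

  \<comment> \<open>Summation of the error coefficients\<close>
  define a where "a n \<omega> = ((\<gamma> * p n - G n * e n \<omega>) / ((G n)\<^sup>2 + \<gamma>))\<^sup>2" for n \<omega>
  have error: "(\<lambda>n. a n \<omega>) sums (l2_norm ?L (\<lambda>x. f x - f\<delta> \<omega> x))\<^sup>2" if "\<omega> \<in> space M" for \<omega>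
  proof -
    have "(?c (\<lambda>x. f x - f\<delta> \<omega> x) n)\<^sup>2 = a n \<omega>" for n
    proof -
      have "(G n)\<^sup>2 + \<gamma> > 0"
        using \<open>\<gamma> > 0\<close> by (simp add: add_nonneg_pos)
      then have "?c (\<lambda>x. f x - f\<delta> \<omega> x) n = (\<gamma> * p n - G n * e n \<omega>) / ((G n)\<^sup>2 + \<gamma>)"
        by (simp add: p_def l2_inner_diff_left f f0 f\<delta>_L2[OF that] phi f\<delta>_coef[OF that]
            power2_eq_square field_simps)
      then show ?thesis
        by (simp add: a_def)
    qed
    with parseval[OF basis L2_diff[OF f f\<delta>_L2[OF that]]] show ?thesis
      by (simp add: l2_norm_square)
  qed
  \<comment> \<open>\<open>b1\<close> bounds the bias and \<open>b2\<close> the noise; the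
    denominator of \<open>b2\<close> is \<open>2 * lam 0 * N\<^sup>2\<close> from the variance times
    \<open>2 * \<gamma>\<close> from the filter.\<close>
  define b1 b2 where "b1 n = 2 * \<gamma>\<^sup>2 / \<kappa> ^ 4 * (lam n ^ 4 * (p n)\<^sup>2)"
    and "b2 n = 1 / (4 * \<gamma> * lam 0 * real (N\<^sup>2)) * (?c g n)\<^sup>2" for n
  have a_int: "integrable M (a n)" for n
  proof -
    have "(\<lambda>\<omega>. 1 / ((G n)\<^sup>2 + \<gamma>) * (\<gamma> * p n - G n * e n \<omega>)) \<in> L2 M"
      by (intro L2_scale L2_diff e_L2) (simp add: L2_def)
    then show ?thesis
      by (simp add: L2_def a_def[abs_def])
  qed
  have a_le: "expectation (a n) \<le> b1 n + b2 n" for n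
  proof -
    have int: "integrable M (\<lambda>\<omega>. (e n \<omega>)\<^sup>2)"
      using e_L2 by (simp add: L2_def)
    \<comment> \<open>With \<open>q = \<kappa> / lam n\<close>, the fourth power in the filter bound
      produces exactly the weight \<open>lam n ^ 4\<close> of the source condition.\<close>
    have "a n \<omega> \<le> b1 n + (e n \<omega>)\<^sup>2 / (2 * \<gamma>)" for \<omega>
      using filter_error_bound[OF \<open>\<gamma> > 0\<close> _ G_ge[of n], of "p n" "e n \<omega>"] \<open>\<kappa> > 0\<close> lam_pos[of n]
      by (simp add: a_def b1_def power_divide mult_ac)
    then have "expectation (a n) \<le> expectation (\<lambda>\<omega>. b1 n + (e n \<omega>)\<^sup>2 / (2 * \<gamma>))"
      using int by (intro integral_mono a_int) auto
    also have "\<dots> = b1 n + (LINT \<omega>|M. (e n \<omega>)\<^sup>2) / (2 * \<gamma>)"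
      using int by (simp add: prob_space)
    also have "\<dots> \<le> b1 n + ((?c g n)\<^sup>2 / (2 * lam 0 * real (N\<^sup>2))) / (2 * \<gamma>)"
      using \<open>\<gamma> > 0\<close> by (intro add_left_mono divide_right_mono e_var) simp
    also have "\<dots> = b1 n + b2 n"
      by (simp add: b2_def)
    finally show ?thesis .
  qed
  have b1: "b1 sums (2 * \<gamma>\<^sup>2 / \<kappa> ^ 4 * (spectral_H2_norm D lam phi (\<lambda>x. f x - f0 x))\<^sup>2)"
  proof -
    have "summable (\<lambda>n. lam n ^ 4 * (p n)\<^sup>2)"
      using source by (simp add: spectral_H2_def p_def)
    moreover from this have "(spectral_H2_norm D lam phi (\<lambda>x. f x - f0 x))\<^sup>2 = (\<Sum>n. lam n ^ 4 * (p n)\<^sup>2)"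
      by (simp add: spectral_H2_norm_def p_def suminf_nonneg)
    ultimately show ?thesis
      unfolding b1_def[abs_def] by (simp only:) (intro sums_mult summable_sums)
  qed
  have b2: "b2 sums ((noise_level D lam g N)\<^sup>2 / (2 * \<gamma>))"
  proof -
    have "b2 sums (1 / (4 * \<gamma> * lam 0 * real (N\<^sup>2)) * l2_inner ?L g g)"
      unfolding b2_def[abs_def] by (intro sums_mult parseval[OF basis g])
    then show ?thesis
      using \<open>0 < lam 0\<close>
      by (simp add: noise_level_def power_mult_distrib power_divide l2_norm_square mult_ac)
  qed
  have a_nonneg: "0 \<le> a n \<omega>" for n \<omega>
    by (simp add: a_def)
  \<comment> \<open>Summable first absolute moments justify exchanging series and
    expectation.\<close>
  have a_summable: "summable (\<lambda>n. expectation (\<lambda>\<omega>. norm (a n \<omega>)))"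
  proof (rule summable_comparison_test'[where N = 0])
    show "summable (\<lambda>n. b1 n + b2 n)"
      using b1 b2 by (intro summable_add) (auto intro: sums_summable)
    show "norm (expectation (\<lambda>\<omega>. norm (a n \<omega>))) \<le> b1 n + b2 n" for n
      using a_le[of n] by (simp add: a_nonneg)
  qed
  have a_AE: "AE \<omega> in M. summable (\<lambda>n. norm (a n \<omega>))"
    using error by (auto simp: a_nonneg dest: sums_summable)
  have eq: "(l2_norm ?L (\<lambda>x. f x - f\<delta> \<omega> x))\<^sup>2 = (\<Sum>n. a n \<omega>)" if "\<omega> \<in> space M" for \<omega>
    using sums_unique[OF error[OF that]] by simp
  show "integrable M (\<lambda>\<omega>. (l2_norm ?L (\<lambda>x. f x - f\<delta> \<omega> x))\<^sup>2)"
    using integrable_suminf[OF a_int a_AE a_summable]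
    by (subst Bochner_Integration.integrable_cong[OF refl eq]) auto
  have "(LINT \<omega>|M. (l2_norm ?L (\<lambda>x. f x - f\<delta> \<omega> x))\<^sup>2) = (\<Sum>n. expectation (a n))"
    using integral_suminf[OF a_int a_AE a_summable]
    by (subst Bochner_Integration.integral_cong[OF refl eq]) auto
  also have "\<dots> \<le> (\<Sum>n. b1 n + b2 n)"
    using a_summable b1 b2
    by (intro suminf_le a_le summable_add) (auto simp: a_nonneg intro: sums_summable)
  also have "\<dots> = 2 * \<gamma>\<^sup>2 / \<kappa> ^ 4 * (spectral_H2_norm D lam phi (\<lambda>x. f x - f0 x))\<^sup>2
      + (noise_level D lam g N)\<^sup>2 / (2 * \<gamma>)"
    by (rule sums_unique[OF sums_add[OF b1 b2], symmetric])
  finally show "(LINT \<omega>|M. (l2_norm ?L (\<lambda>x. f x - f\<delta> \<omega> x))\<^sup>2)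
      \<le> 2 * \<gamma>\<^sup>2 * (spectral_H2_norm D lam phi (\<lambda>x. f x - f0 x))\<^sup>2 / (C_R * (1 - exp (- lam 0 * T))) ^ 4
        + (noise_level D lam g N)\<^sup>2 / (2 * \<gamma>)"
    by (simp add: \<kappa>_def)
qed

section \<open>Choice of the regularisation parameter\<close>

theorem theorem3p2:
  fixes D :: "(real ^ 'd) set"
    and a :: "'d \<Rightarrow> 'd \<Rightarrow> real ^ 'd \<Rightarrow> real" and c :: "real ^ 'd \<Rightarrow> real"
    and lam :: "nat \<Rightarrow> real" and phi :: "nat \<Rightarrow> real ^ 'd \<Rightarrow> real"
    and M :: "'w measure" and \<F> :: "real \<Rightarrow> 'w measure" and w :: "real \<Rightarrow> 'w \<Rightarrow> real"
    and T C_R :: real and R :: "real \<Rightarrow> real"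
    and u0 f g f0 h :: "real ^ 'd \<Rightarrow> real"
    and u :: "real \<Rightarrow> 'w \<Rightarrow> real ^ 'd \<Rightarrow> real"
  assumes "CARD('d) \<in> {1, 2, 3}"
    and "T > 0"
    and "bounded_lipschitz_domain D"
    and "elliptic_coefficients D a c"
    and "dirichlet_eigensystem D a c lam phi"
    and "complete_filtered_prob_space M \<F>"
    and "brownian_motion M \<F> w"
    and "u0 \<in> L2 (lebesgue_on D)" and "f \<in> L2 (lebesgue_on D)" and "g \<in> L2 (lebesgue_on D)"
    and "R \<in> Linfty (lebesgue_on {0..T})"
    and "C_R > 0" and "AE t in lebesgue_on {0..T}. C_R \<le> R t"
    and "(\<lambda>x. f x - f0 x) \<in> spectral_H2 D lam phi"
    and "mild_solution M w D lam phi T R u0 f g u"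
    and "h = forward_op D lam phi T R f" and "h \<in> L2 (lebesgue_on D)"
  shows "\<exists>C C1. C > 0 \<and> C1 > 0 \<and> 
    C = 2 * (spectral_H2_norm D lam phi (\<lambda>x. f x - f0 x))\<^sup>2 * C1\<^sup>2
          / (C_R * (1 - exp (- lam 0 * T))) ^ 4 + 1 / (2 * C1) \<and>
    (\<forall>N \<gamma> obs f\<delta>.
       N \<ge> 1 \<and>
       independent_copies M D (N\<^sup>2) (u T) obs \<and>
       (\<forall>\<omega>\<in>space M. noisy_data D lam phi T u0 N obs \<omega> \<in> L2 (lebesgue_on D)) \<and>
       \<gamma> > 0 \<and> \<gamma> = C1 * noise_level D lam g N powr (2 / 3) \<and>
       (\<forall>\<omega>\<in>space M.
          is_arg_min (tikhonov D lam phi T R (noisy_data D lam phi T u0 N obs \<omega>) f0 \<gamma>)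
            (\<lambda>v. v \<in> L2 (lebesgue_on D)) (f\<delta> \<omega>)) \<longrightarrow>
       integrable M (\<lambda>\<omega>. (l2_norm (lebesgue_on D) (\<lambda>x. f x - f\<delta> \<omega> x))\<^sup>2) \<and>
       prob_space.expectation M (\<lambda>\<omega>. (l2_norm (lebesgue_on D) (\<lambda>x. f x - f\<delta> \<omega> x))\<^sup>2)
         \<le> C * noise_level D lam g N powr (4 / 3))"
proof -
  let ?K = "spectral_H2_norm D lam phi (\<lambda>x. f x - f0 x)"
  let ?\<kappa> = "C_R * (1 - exp (- lam 0 * T))"
  have eig: "orthonormal_basis (lebesgue_on D) phi" "0 < lam 0" "incseq lam"
    using assms(5) by (auto simp: dirichlet_eigensystem_def)
  \<comment> \<open>The prescribed constant at \<open>C1 = 1\<close>, with the factors 1 left in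
    place so that it matches the required form literally.\<close>
  define C where "C = 2 * ?K\<^sup>2 * 1\<^sup>2 / ?\<kappa> ^ 4 + 1 / (2 * 1)"
  have "C > 0"
    unfolding C_def by (intro add_nonneg_pos) auto
  have bound: "integrable M (\<lambda>\<omega>. (l2_norm (lebesgue_on D) (\<lambda>x. f x - f\<delta> \<omega> x))\<^sup>2) \<and>
      prob_space.expectation M (\<lambda>\<omega>. (l2_norm (lebesgue_on D) (\<lambda>x. f x - f\<delta> \<omega> x))\<^sup>2)
         \<le> C * noise_level D lam g N powr (4 / 3)"
    if H: "N \<ge> 1" "independent_copies M D (N\<^sup>2) (u T) obs" "\<gamma> > 0"
      "\<gamma> = 1 * noise_level D lam g N powr (2 / 3)"
      "\<forall>\<omega>\<in>space M. is_arg_min (tikhonov D lam phi T R (noisy_data D lam phi T u0 N obs \<omega>) f0 \<gamma>)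
        (\<lambda>v. v \<in> L2 (lebesgue_on D)) (f\<delta> \<omega>)"
    for N \<gamma> obs f\<delta>
  proof -
    let ?\<delta> = "noise_level D lam g N"
    have "?\<delta> \<ge> 0"
      using eig by (simp add: noise_level_def l2_norm_nonneg)
    \<comment> \<open>\<open>0 powr (2 / 3)\<close> is 0, so a positive \<open>\<gamma>\<close>
      excludes a zero noise level.\<close>
    moreover have "?\<delta> \<noteq> 0"
      using H(3,4) by auto
    ultimately have "?\<delta> > 0"
      by simp
    \<comment> \<open>The exponent 2/3 balances the error: \<open>\<gamma>\<^sup>2\<close> from the
      bias and \<open>?\<delta>\<^sup>2 / \<gamma>\<close> from the noise both become
      \<open>?\<delta> powr (4 / 3)\<close>.\<close>
    have sq: "\<gamma>\<^sup>2 = ?\<delta> powr (4 / 3)"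
      using H(4) by (simp add: power2_eq_square flip: powr_add)
    have "?\<delta>\<^sup>2 = ?\<delta> powr 2"
      using \<open>?\<delta> > 0\<close> by simp
    then have quot: "?\<delta>\<^sup>2 / \<gamma> = ?\<delta> powr (4 / 3)"
      using H(4) by (simp flip: powr_diff)
    have "C * ?\<delta> powr (4 / 3) = 2 * \<gamma>\<^sup>2 * ?K\<^sup>2 / ?\<kappa> ^ 4 + ?\<delta>\<^sup>2 / \<gamma> / 2"
      unfolding sq quot by (simp add: C_def distrib_right)
    then show ?thesis
      using tikhonov_expected_error[OF assms(2,6,7) eig assms(8-15) H(1-3), of f\<delta>] H(5)
      by (simp add: mult.commute)
  qed
  show ?thesis
    by (rule exI[of _ C], rule exI[of _ 1], intro conjI allI impI; (elim conjE)?)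
      (use \<open>C > 0\<close> in \<open>auto simp only: C_def[symmetric] zero_less_one dest: bound\<close>)
qed

end
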